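(* Let $\mathbb{K}=\mathbb{C}$ or $\mathbb{H}$. For any $n\geq 1$ (including $n=\infty$), there is a homeomorphism $$m\colon (D_o(\theta_n),\,\varGamma_n)\;\longrightarrow\;(SP^2_n\setminus\varDelta_n,\,\varGamma_n)$$ of pairs, which induces a deformation retraction of $SP^2_n\setminus\varDelta_n$ onto $\varGamma_n$.
   Context: Let $d=\dim_{\mathbb{R}}\mathbb{K}\in\{2,4\}$. Scalars act on the right of $\mathbb{K}^{n+1}$, and $u^\star v=\bar u_1v_1+\cdots+\bar u_{n+1}v_{n+1}$. $\mathbb{K}P^n$ is the quotient of the unit sphere $S^{(n+1)d-1}\subset\mathbb K^{n+1}$ by $S^{d-1}\subset\mathbb{K}^\times$. $SP^2_n=SP^2(\mathbb{K}P^n)=(\mathbb{K}P^n\times\mathbb{K}P^n)/C_2$ is the space of unordered pairs of lines, and $\varDelta_n\cong\mathbb{K}P^n$ is its diagonal. $P^d$ is the group of matrices $\begin{pmatrix}a&0\\ 0&b\end{pmatrix}$, $\begin{pmatrix}0&a\\ b&0\end{pmatrix}$ with $a,b\in S^{d-1}$ (isomorphic to $Pin^c(2)$ for $d=2$ and $Pin^-(4)$ for $d=4$), and $\tau=\begin{pmatrix}0&1\\ 1&0\end{pmatrix}\in P^d$. $V_{n+1,2}$ is the Stiefel manifold of orthonormal $2$-frames $(u\;v)$ in $\mathbb{K}^{n+1}$, with right $P^d$-action by matrix multiplication. $\varGamma_n=V_{n+1,2}/P^d$ is the space of unordered pairs of orthogonal lines in $\mathbb K^{n+1}$; it is regarded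 as a subspace of $SP^2_n\setminus\varDelta_n$. $P^d$ acts on the left of $\mathbb{K}$ by $\tau\cdot k=\bar k$ and $\begin{pmatrix}a&0\\ 0&b\end{pmatrix}\cdot k=ak\bar b$; $\theta_n$ is the real $d$-plane bundle $V_{n+1,2}\times_{P^d}\mathbb{K}\to\varGamma_n$, and $D_o(\theta_n)=V_{n+1,2}\times_{P^d}D_o^d$ is the total space of its open unit disc bundle, where $D_o^d=\{k\in\mathbb K:|k|<1\}$. $\varGamma_n\subset D_o(\theta_n)$ is the zero section. For $n=\infty$ all spaces are the colimits of those for finite $n$. *)

theory Defs
  imports "HOL-Analysis.Analysis" "HOL-Library.Uprod"
begin

section \<open>The scalars\<close>

codatatype quat = Quat (qRe: real) (qI: real) (qJ: real) (qK: real)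

lemma quat_eq_iff: "x = y \<longleftrightarrow> qRe x = qRe y \<and> qI x = qI y \<and> qJ x = qJ y \<and> qK x = qK y"
  by (auto intro: quat.expand)

instantiation quat :: ab_group_add
begin

primcorec zero_quat where
  "qRe 0 = 0" | "qI 0 = 0" | "qJ 0 = 0" | "qK 0 = 0"

primcorec plus_quat where
  "qRe (x + y) = qRe x + qRe y"
| "qI (x + y) = qI x + qI y"
| "qJ (x + y) = qJ x + qJ y"
| "qK (x + y) = qK x + qK y"

primcorec uminus_quat where
  "qRe (- x) = - qRe x" | "qI (- x) = - qI x" | "qJ (- x) = - qJ x" | "qK (- x) = - qK x"

primcorec minus_quat where
  "qRe (x - y) = qRe x - qRe y"
| "qI (x - y) = qI x - qI y"
| "qJ (x - y) = qJ x - qJ y"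
| "qK (x - y) = qK x - qK y"

instance by standard (simp_all add: quat_eq_iff)

end

instantiation quat :: real_vector
begin

primcorec scaleR_quat where
  "qRe (scaleR r x) = r * qRe x"
| "qI (scaleR r x) = r * qI x"
| "qJ (scaleR r x) = r * qJ x"
| "qK (scaleR r x) = r * qK x"

instance by standard (simp_all add: quat_eq_iff algebra_simps)

end

instantiation quat :: real_algebra_1
begin

primcorec one_quat where
  "qRe 1 = 1" | "qI 1 = 0" | "qJ 1 = 0" | "qK 1 = 0"

primcorec times_quat where
  "qRe (x * y) = qRe x * qRe y - qI x * qI y - qJ x * qJ y - qK x * qK y"
| "qI (x * y) = qRe x * qI y + qI x * qRe y + qJ x * qK y - qK x * qJ y"
| "qJ (x * y) = qRe x * qJ y - qI x * qK y + qJ x * qRe y + qK x * qI y"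
| "qK (x * y) = qRe x * qK y + qI x * qJ y - qJ x * qI y + qK x * qRe y"

instance by standard (simp_all add: quat_eq_iff algebra_simps)

end

instantiation quat :: real_inner
begin

definition inner_quat_def:
  "inner x y = qRe x * qRe y + qI x * qI y + qJ x * qJ y + qK x * qK y"

definition norm_quat_def:
  "norm x = sqrt ((qRe x)\<^sup>2 + (qI x)\<^sup>2 + (qJ x)\<^sup>2 + (qK x)\<^sup>2)" for x :: quat

definition sgn_quat_def: "sgn x = x /\<^sub>R norm x" for x :: quat

definition dist_quat_def: "dist x y = norm (x - y)" for x y :: quat

definition uniformity_quat_def [code del]:
  "(uniformity :: (quat \<times> quat) filter) = (INF e\<in>{0 <..}. principal {(x, y). dist x y < e})"

definition open_quat_def [code del]:
  "open (U :: quat set) \<longleftrightarrow> (\<forall>x\<in>U. eventually (\<lambda>(x', y). x' = x \<longrightarrow> y \<in> U) uniformity)"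

instance
proof
  fix x y z :: quat and r :: real and S :: "quat set"
  show "inner x x = 0 \<longleftrightarrow> x = 0"
  proof -
    have "inner x x = 0 \<longleftrightarrow> qRe x * qRe x + qI x * qI x + (qJ x * qJ x + qK x * qK x) = 0"
      by (simp add: inner_quat_def add.assoc)
    also have "\<dots> \<longleftrightarrow> qRe x * qRe x + qI x * qI x = 0 \<and> qJ x * qJ x + qK x * qK x = 0"
      by (intro add_nonneg_eq_0_iff) simp_all
    finally show ?thesis by (simp add: quat_eq_iff)
  qed
  show "norm x = sqrt (inner x x)"
    by (simp add: norm_quat_def inner_quat_def power2_eq_square)
qed (simp_all add: inner_quat_def algebra_simps sgn_quat_def dist_quat_def
       uniformity_quat_def open_quat_def)

end

instantiation quat :: real_normed_div_algebra
begin

definition inverse_quat_def: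
  "inverse x = Quat (qRe x) (- qI x) (- qJ x) (- qK x) /\<^sub>R (norm x)\<^sup>2" for x :: quat

definition divide_quat_def: "x div y = x * inverse y" for x y :: quat

instance
proof
  fix x y :: quat
  have sq: "(norm x)\<^sup>2 = qRe x * qRe x + qI x * qI x + qJ x * qJ x + qK x * qK x"
    by (simp add: norm_quat_def power2_eq_square)
  { assume "x \<noteq> 0"
    then have nz: "(norm x)\<^sup>2 \<noteq> 0" by simp
    have "inverse x * x = ((norm x)\<^sup>2 / (norm x)\<^sup>2) *\<^sub>R 1"
      by (simp add: inverse_quat_def quat_eq_iff sq field_simps)
    then show "inverse x * x = 1" using nz by simp
    have "x * inverse x = ((norm x)\<^sup>2 / (norm x)\<^sup>2) *\<^sub>R 1"
      by (simp add: inverse_quat_def quat_eq_iff sq field_simps)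
    then show "x * inverse x = 1" using nz by simp }
  show "inverse (0::quat) = 0" by (simp add: inverse_quat_def)
  show "norm (x * y) = norm x * norm y"
    unfolding norm_quat_def real_sqrt_mult [symmetric]
    by (rule arg_cong [of _ _ sqrt]) (simp add: power2_eq_square algebra_simps)
qed (simp add: divide_quat_def)

end

instantiation quat :: euclidean_space
begin

definition Basis_quat_def: "Basis = {Quat 1 0 0 0, Quat 0 1 0 0, Quat 0 0 1 0, Quat 0 0 0 1}"

instance
proof
  show "inner u v = (if u = v then 1 else 0)" if "u \<in> Basis" "v \<in> Basis" for u v :: quat
    using that unfolding Basis_quat_def by (elim insertE emptyE) (simp_all add: inner_quat_def)
  show "(\<forall>u\<in>Basis. inner x u = 0) \<longleftrightarrow> x = 0" for x :: quat
    unfolding Basis_quat_def by (simp add: inner_quat_def quat_eq_iff [of x 0])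
qed (simp_all add: Basis_quat_def)

end

lemma DIM_quat [simp]: "DIM(quat) = 4"
  by (simp add: Basis_quat_def)

text \<open>A common interface to \<open>\<complex>\<close> and \<open>\<H>\<close>, which are its only instances below. The
  dimension \<open>d\<close> is \<open>DIM('k)\<close>, and \<open>S\<^sup>d\<^sup>-\<^sup>1\<close> is \<open>{a. norm a = 1}\<close>.\<close>

class conj_division_algebra = real_normed_div_algebra + euclidean_space +
  fixes kconj :: "'a \<Rightarrow> 'a"
  assumes kconj_add: "kconj (x + y) = kconj x + kconj y"
    and kconj_scaleR: "kconj (scaleR r x) = scaleR r (kconj x)"
    and kconj_mult: "kconj (x * y) = kconj y * kconj x"
    and kconj_kconj [simp]: "kconj (kconj x) = x"
    and kconj_mult_self_scaleR: "kconj x * x = scaleR ((norm x)\<^sup>2) 1"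

instantiation complex :: conj_division_algebra
begin

definition kconj_complex_def: "kconj = cnj"

instance
proof
  show "kconj x * x = scaleR ((norm x)\<^sup>2) 1" for x :: complex
    by (metis complex_norm_square kconj_complex_def mult.commute of_real_def)
qed (simp_all add: kconj_complex_def)

end

instantiation quat :: conj_division_algebra
begin

primcorec kconj_quat where
  "qRe (kconj x) = qRe x" | "qI (kconj x) = - qI x"
| "qJ (kconj x) = - qJ x" | "qK (kconj x) = - qK x"

instance
  by standard (simp_all add: quat_eq_iff algebra_simps of_real_def norm_quat_def power2_eq_square)

end


section \<open>Quotient spaces and colimits\<close>

text \<open>The quotient of \<open>X\<close> by the equivalence relation \<open>q x = q y\<close>. Below, \<open>q\<close> always sends a
  point to its orbit under a group action.\<close>

definition quotient_topology :: "'a topology \<Rightarrow> ('a \<Rightarrow> 'b) \<Rightarrow> 'b topology" where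
  "quotient_topology X q =
     topology (\<lambda>U. U \<subseteq> q ` topspace X \<and> openin X {x \<in> topspace X. q x \<in> U})"

lemma openin_quotient_topology:
  "openin (quotient_topology X q) U \<longleftrightarrow> U \<subseteq> q ` topspace X \<and> openin X {x \<in> topspace X. q x \<in> U}"
proof -
  have "istopology (\<lambda>U. U \<subseteq> q ` topspace X \<and> openin X {x \<in> topspace X. q x \<in> U})"
    unfolding istopology_def
  proof (rule conjI; clarify)
    fix S T
    assume "openin X {x \<in> topspace X. q x \<in> S}" "openin X {x \<in> topspace X. q x \<in> T}"
      and ST: "S \<subseteq> q ` topspace X"
    moreover have "{x \<in> topspace X. q x \<in> S \<inter> T} =
        {x \<in> topspace X. q x \<in> S} \<inter> {x \<in> topspace X. q x \<in> T}" by auto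
    ultimately have "openin X {x \<in> topspace X. q x \<in> S \<inter> T}" by auto
    then show "S \<inter> T \<subseteq> q ` topspace X \<and> openin X {x \<in> topspace X. q x \<in> S \<inter> T}"
      using ST by blast
  next
    fix \<K> assume *: "\<forall>K\<in>\<K>. K \<subseteq> q ` topspace X \<and> openin X {x \<in> topspace X. q x \<in> K}"
    have "{x \<in> topspace X. q x \<in> \<Union>\<K>} = (\<Union>K\<in>\<K>. {x \<in> topspace X. q x \<in> K})" by auto
    moreover have "openin X (\<Union>K\<in>\<K>. {x \<in> topspace X. q x \<in> K})" using * by blast
    ultimately have "openin X {x \<in> topspace X. q x \<in> \<Union>\<K>}" by simp
    then show "\<Union>\<K> \<subseteq> q ` topspace X \<and> openin X {x \<in> topspace X. q x \<in> \<Union>\<K>}"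
      using * by blast
  qed
  then show ?thesis by (simp add: quotient_topology_def)
qed

lemma topspace_quotient_topology [simp]: "topspace (quotient_topology X q) = q ` topspace X"
proof (rule antisym)
  show "topspace (quotient_topology X q) \<subseteq> q ` topspace X"
    using openin_quotient_topology openin_topspace by metis
  have "{x \<in> topspace X. q x \<in> q ` topspace X} = topspace X" by auto
  then have "openin (quotient_topology X q) (q ` topspace X)"
    by (simp add: openin_quotient_topology)
  then show "q ` topspace X \<subseteq> topspace (quotient_topology X q)"
    by (rule openin_subset)
qed

lemma quotient_map_quotient_topology: "quotient_map X (quotient_topology X q) q"
  by (simp add: quotient_map_def openin_quotient_topology)

text \<open>The colimit of a sequence of spaces along inclusions
  \<open>topspace (X n) \<subseteq> topspace (X (Suc n))\<close>: the union with the weak topology.\<close>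

definition colimit_topology :: "(nat \<Rightarrow> 'a topology) \<Rightarrow> 'a topology" where
  "colimit_topology X =
     topology (\<lambda>U. U \<subseteq> (\<Union>n. topspace (X n)) \<and> (\<forall>n. openin (X n) (U \<inter> topspace (X n))))"

lemma openin_colimit_topology:
  "openin (colimit_topology X) U \<longleftrightarrow>
     U \<subseteq> (\<Union>n. topspace (X n)) \<and> (\<forall>n. openin (X n) (U \<inter> topspace (X n)))"
proof -
  have "istopology (\<lambda>U. U \<subseteq> (\<Union>n. topspace (X n)) \<and> (\<forall>n. openin (X n) (U \<inter> topspace (X n))))"
    unfolding istopology_def
  proof (rule conjI; clarify)
    fix S T
    assume S: "S \<subseteq> (\<Union>n. topspace (X n))" "\<forall>n. openin (X n) (S \<inter> topspace (X n))"
      and T: "\<forall>n. openin (X n) (T \<inter> topspace (X n))"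
    have "S \<inter> T \<inter> topspace (X n) = (S \<inter> topspace (X n)) \<inter> (T \<inter> topspace (X n))" for n
      by auto
    then have "openin (X n) (S \<inter> T \<inter> topspace (X n))" for n
      using S T by (metis openin_Int)
    then show "S \<inter> T \<subseteq> (\<Union>n. topspace (X n)) \<and> (\<forall>n. openin (X n) (S \<inter> T \<inter> topspace (X n)))"
      using S by blast
  next
    fix \<K>
    assume *: "\<forall>K\<in>\<K>. K \<subseteq> (\<Union>n. topspace (X n)) \<and> (\<forall>n. openin (X n) (K \<inter> topspace (X n)))"
    have "\<Union>\<K> \<inter> topspace (X n) = (\<Union>K\<in>\<K>. K \<inter> topspace (X n))" for n by auto
    moreover have "openin (X n) (\<Union>K\<in>\<K>. K \<inter> topspace (X n))" for n using * by blast
    ultimately have "\<forall>n. openin (X n) (\<Union>\<K> \<inter> topspace (X n))" by simp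
    then show "\<Union>\<K> \<subseteq> (\<Union>n. topspace (X n)) \<and> (\<forall>n. openin (X n) (\<Union>\<K> \<inter> topspace (X n)))"
      using * by blast
  qed
  then show ?thesis by (simp add: colimit_topology_def)
qed

lemma topspace_colimit_topology [simp]:
  "topspace (colimit_topology X) = (\<Union>n. topspace (X n))"
proof (rule antisym)
  show "topspace (colimit_topology X) \<subseteq> (\<Union>n. topspace (X n))"
    using openin_colimit_topology openin_topspace by metis
  have "(\<Union>n. topspace (X n)) \<inter> topspace (X m) = topspace (X m)" for m by auto
  then have "openin (colimit_topology X) (\<Union>n. topspace (X n))"
    by (simp add: openin_colimit_topology)
  then show "(\<Union>n. topspace (X n)) \<subseteq> topspace (colimit_topology X)"
    by (rule openin_subset)
qed

definition up_to_infinity :: "(nat \<Rightarrow> 'a topology) \<Rightarrow> enat \<Rightarrow> 'a topology" where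
  "up_to_infinity X n = (case n of enat m \<Rightarrow> X m | \<infinity> \<Rightarrow> colimit_topology X)"


section \<open>Projective spaces and symmetric squares\<close>

text \<open>A vector in \<open>\<K>\<^sup>n\<^sup>+\<^sup>1\<close> is a sequence \<open>nat \<Rightarrow> 'k\<close> vanishing beyond index \<open>n\<close>, so that the
  standard inclusions \<open>\<K>\<^sup>n\<^sup>+\<^sup>1 \<subseteq> \<K>\<^sup>n\<^sup>+\<^sup>2\<close>, and with them the inclusions of all the spaces below,
  are set inclusions. For finite \<open>n\<close>, the product topology on sequences (\<open>euclidean\<close>) induces
  the usual topology on \<open>\<K>\<^sup>n\<^sup>+\<^sup>1\<close>.\<close>

type_synonym 'k vec_seq = "nat \<Rightarrow> 'k"
type_synonym 'k line = "'k vec_seq set"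
type_synonym 'k frame = "'k vec_seq \<times> 'k vec_seq"

definition Kvec :: "nat \<Rightarrow> ('k::conj_division_algebra) vec_seq set" where
  "Kvec n = {u. \<forall>i>n. u i = 0}"

definition herm :: "nat \<Rightarrow> ('k::conj_division_algebra) vec_seq \<Rightarrow> 'k vec_seq \<Rightarrow> 'k" where
  "herm n u v = (\<Sum>i\<le>n. kconj (u i) * v i)"

definition Ksphere :: "nat \<Rightarrow> ('k::conj_division_algebra) vec_seq set" where
  "Ksphere n = {u \<in> Kvec n. herm n u u = 1}"

definition line :: "('k::conj_division_algebra) vec_seq \<Rightarrow> 'k line" where
  "line u = {\<lambda>i. u i * a | a. norm a = 1}"

definition KP_fin :: "nat \<Rightarrow> ('k::conj_division_algebra) line topology" where
  "KP_fin n = quotient_topology (top_of_set (Ksphere n)) line"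

definition KP :: "enat \<Rightarrow> ('k::conj_division_algebra) line topology" where
  "KP = up_to_infinity KP_fin"

text \<open>The \<open>C\<^sub>2\<close>-orbit of \<open>(x, y)\<close> is the unordered pair \<open>Upair x y\<close>.\<close>

definition symmetric_square :: "'a topology \<Rightarrow> 'a uprod topology" where
  "symmetric_square X = quotient_topology (prod_topology X X) (\<lambda>(x, y). Upair x y)"

definition SP2 :: "enat \<Rightarrow> ('k::conj_division_algebra) line uprod topology" where
  "SP2 = up_to_infinity (\<lambda>m. symmetric_square (KP_fin m))"

definition diagonal :: "enat \<Rightarrow> ('k::conj_division_algebra) line uprod set" where
  "diagonal n = {Upair x x | x. x \<in> topspace (KP n)}"

definition SP2_minus_diagonal :: "enat \<Rightarrow> ('k::conj_division_algebra) line uprod topology" where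
  "SP2_minus_diagonal n = subtopology (SP2 n) (topspace (SP2 n) - diagonal n)"


section \<open>The group \<open>P\<^sup>d\<close>, orthonormal frames and the disc bundle\<close>

type_synonym 'k mat2 = "'k^2^2"

definition mat22 :: "'k \<Rightarrow> 'k \<Rightarrow> 'k \<Rightarrow> 'k \<Rightarrow> ('k::conj_division_algebra) mat2" where
  "mat22 a b c d = vector [vector [a, b], vector [c, d]]"

lemma mat22_nth [simp]:
  "mat22 a b c d $ 1 $ 1 = a" "mat22 a b c d $ 1 $ 2 = b"
  "mat22 a b c d $ 2 $ 1 = c" "mat22 a b c d $ 2 $ 2 = d"
  by (simp_all add: mat22_def)

definition Pgrp :: "('k::conj_division_algebra) mat2 set" where
  "Pgrp = {mat22 a 0 0 b | a b. norm a = 1 \<and> norm b = 1} \<union>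
          {mat22 0 a b 0 | a b. norm a = 1 \<and> norm b = 1}"

definition frame_act :: "('k::conj_division_algebra) frame \<Rightarrow> 'k mat2 \<Rightarrow> 'k frame" where
  "frame_act f M = (\<lambda>i. fst f i * M$1$1 + snd f i * M$2$1, \<lambda>i. fst f i * M$1$2 + snd f i * M$2$2)"

text \<open>The antidiagonal case is forced by \<open>mat22 0 a b 0 = mat22 a 0 0 b ** mat22 0 1 1 0\<close>;
  see \<open>fibre_act_mult\<close>.\<close>

definition fibre_act :: "('k::conj_division_algebra) mat2 \<Rightarrow> 'k \<Rightarrow> 'k" where
  "fibre_act M k = (if M$1$2 = 0 then M$1$1 * k * kconj (M$2$2)
                    else M$1$2 * kconj k * kconj (M$2$1))"

definition Stiefel :: "nat \<Rightarrow> ('k::conj_division_algebra) frame set" where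
  "Stiefel n = {(u, v). u \<in> Kvec n \<and> v \<in> Kvec n \<and>
                        herm n u u = 1 \<and> herm n v v = 1 \<and> herm n u v = 0}"

definition frame_orbit :: "('k::conj_division_algebra) frame \<Rightarrow> 'k frame set" where
  "frame_orbit f = {frame_act f g | g. g \<in> Pgrp}"

definition Gamma_space :: "enat \<Rightarrow> ('k::conj_division_algebra) frame set topology" where
  "Gamma_space = up_to_infinity (\<lambda>m. quotient_topology (top_of_set (Stiefel m)) frame_orbit)"

text \<open>The class of \<open>(f, k)\<close> in the associated bundle, for the relation
  \<open>(f g, k') \<sim> (f, g \<cdot> k')\<close> with \<open>g \<in> P\<^sup>d\<close>.\<close>

definition assoc_class :: "('k::conj_division_algebra) frame \<times> 'k \<Rightarrow> ('k frame \<times> 'k) set" where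
  "assoc_class p = {(frame_act (fst p) g, k') | g k'. g \<in> Pgrp \<and> fibre_act g k' = snd p}"

definition assoc_bundle ::
    "('k::conj_division_algebra) set \<Rightarrow> nat \<Rightarrow> ('k frame \<times> 'k) set topology" where
  "assoc_bundle F n =
     quotient_topology (prod_topology (top_of_set (Stiefel n)) (top_of_set F)) assoc_class"

text \<open>\<open>theta\<close> is the total space of the \<open>d\<close>-plane bundle, \<open>Do_theta\<close> that of its open unit
  disc bundle.\<close>

definition theta :: "enat \<Rightarrow> (('k::conj_division_algebra) frame \<times> 'k) set topology" where
  "theta = up_to_infinity (assoc_bundle UNIV)"

definition Do_theta :: "enat \<Rightarrow> (('k::conj_division_algebra) frame \<times> 'k) set topology" where
  "Do_theta = up_to_infinity (assoc_bundle (ball 0 1))"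

text \<open>The two ways in which \<open>Gamma_space n\<close> is regarded as a subspace. On an orbit \<open>E\<close> of frames,
  \<open>zero_section E\<close> is the class of \<open>(f, 0)\<close> for any \<open>f \<in> E\<close>, and \<open>Gamma_incl E\<close> is the common
  value of \<open>line_pair\<close> on \<open>E\<close>; see \<open>zero_section_frame_orbit\<close> and \<open>Gamma_incl_frame_orbit\<close>.\<close>

definition zero_section ::
    "('k::conj_division_algebra) frame set \<Rightarrow> ('k frame \<times> 'k) set" where
  "zero_section E = E \<times> {0}"

definition line_pair :: "('k::conj_division_algebra) frame \<Rightarrow> 'k line uprod" where
  "line_pair f = Upair (line (fst f)) (line (snd f))"

definition Gamma_incl :: "('k::conj_division_algebra) frame set \<Rightarrow> 'k line uprod" where
  "Gamma_incl E = the_elem (line_pair ` E)"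

text \<open>Fibrewise radial contraction of the disc bundle onto its zero section:
  the class of \<open>(f, k)\<close> is sent to the class of \<open>(f, (1 - t) k)\<close>; see \<open>radial_assoc_class\<close>.\<close>

definition radial :: "real \<Rightarrow> (('k::conj_division_algebra) frame \<times> 'k) set \<Rightarrow> ('k frame \<times> 'k) set"
  where "radial t E = (\<lambda>(f, k). (f, (1 - t) *\<^sub>R k)) ` E"


section \<open>Pairs and deformation retractions\<close>

definition homeomorphism_of_pairs ::
    "'a topology \<Rightarrow> 'a set \<Rightarrow> 'b topology \<Rightarrow> 'b set \<Rightarrow> ('a \<Rightarrow> 'b) \<Rightarrow> bool" where
  "homeomorphism_of_pairs X A Y B m \<longleftrightarrow>
     A \<subseteq> topspace X \<and> B \<subseteq> topspace Y \<and> homeomorphic_map X Y m \<and> m ` A = B"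

definition deformation_retraction :: "'a topology \<Rightarrow> 'a set \<Rightarrow> (real \<times> 'a \<Rightarrow> 'a) \<Rightarrow> bool" where
  "deformation_retraction X A h \<longleftrightarrow>
     A \<subseteq> topspace X \<and>
     continuous_map (prod_topology (top_of_set {0..1}) X) X h \<and>
     (\<forall>x\<in>topspace X. h (0, x) = x) \<and>
     (\<forall>x\<in>topspace X. h (1, x) \<in> A) \<and>
     (\<forall>t\<in>{0..1}. \<forall>a\<in>A. h (t, a) = a)"


section \<open>Consistency of the encodings\<close>

lemma kconj_mult_self: "kconj x * x = of_real ((norm x)\<^sup>2)" for x :: "'k::conj_division_algebra"
  by (simp add: kconj_mult_self_scaleR of_real_def)

lemma norm_kconj [simp]: "norm (kconj x :: 'k::conj_division_algebra) = norm x"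
proof (cases "x = 0")
  case True
  then show ?thesis using kconj_scaleR [of 0 x] by simp
next
  case False
  have "norm (kconj x) * norm x = norm x * norm x"
    by (metis abs_norm_cancel kconj_mult_self norm_mult norm_of_real power2_eq_square)
  then show ?thesis using False by simp
qed

lemma kconj_0 [simp]: "kconj (0 :: 'k::conj_division_algebra) = 0"
  using kconj_scaleR [of 0 "0 :: 'k"] by simp

lemma kconj_1 [simp]: "kconj (1 :: 'k::conj_division_algebra) = 1"
  using kconj_mult_self [of "1 :: 'k"] by simp

lemma kconj_self_mult: "x * kconj x = of_real ((norm x)\<^sup>2)" for x :: "'k::conj_division_algebra"
  using kconj_mult_self [of "kconj x"] by simp

lemma fibre_act_diag: "b \<noteq> 0 \<Longrightarrow> fibre_act (mat22 a 0 0 b) k = a * k * kconj b"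
  by (simp add: fibre_act_def)

lemma fibre_act_tau: "fibre_act (mat22 0 1 1 0) k = kconj k"
  by (simp add: fibre_act_def)

lemma mat22_mult:
  "mat22 a b c d ** mat22 a' b' c' d' =
     mat22 (a * a' + b * c') (a * b' + b * d') (c * a' + d * c') (c * b' + d * d')"
  by (simp add: vec_eq_iff matrix_matrix_mult_def sum_2 forall_2)

lemma Pgrp_cases [case_names diag antidiag]:
  assumes "g \<in> Pgrp"
  obtains a b where "g = mat22 a 0 0 b" "norm a = 1" "norm b = 1"
  | a b where "g = mat22 0 a b 0" "norm a = 1" "norm b = 1"
  using assms by (auto simp: Pgrp_def)

lemma Pgrp_intros:
  assumes "norm a = 1" "norm b = 1"
  shows "mat22 a 0 0 b \<in> Pgrp" "mat22 0 a b 0 \<in> Pgrp"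
  using assms unfolding Pgrp_def by blast+

lemma Pgrp_mult: "g \<in> Pgrp \<Longrightarrow> h \<in> Pgrp \<Longrightarrow> g ** h \<in> Pgrp"
  by (erule Pgrp_cases; erule Pgrp_cases) (simp_all add: mat22_mult norm_mult Pgrp_intros)

lemma Pgrp_one: "mat 1 \<in> Pgrp"
proof -
  have "(mat 1 :: 'a mat2) = mat22 1 0 0 1"
    by (simp add: vec_eq_iff mat_def forall_2)
  then show ?thesis by (simp add: Pgrp_intros)
qed

lemma frame_act_mult: "frame_act f (g ** h) = frame_act (frame_act f g) h"
  by (simp add: frame_act_def matrix_matrix_mult_def sum_2 fun_eq_iff algebra_simps)

lemma fibre_act_mult:
  "g \<in> Pgrp \<Longrightarrow> h \<in> Pgrp \<Longrightarrow> fibre_act (g ** h) k = fibre_act g (fibre_act h k)"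
  by (erule Pgrp_cases; erule Pgrp_cases; elim ssubst)
     (auto simp: fibre_act_def mat22_mult kconj_mult mult.assoc)

lemma fibre_act_scaleR: "fibre_act g (r *\<^sub>R k) = r *\<^sub>R fibre_act g k"
  by (simp add: fibre_act_def kconj_scaleR)

lemma norm_fibre_act [simp]: "g \<in> Pgrp \<Longrightarrow> norm (fibre_act g k) = norm k"
  by (erule Pgrp_cases) (auto simp: fibre_act_def norm_mult)

lemma Pgrp_inverse:
  assumes "g \<in> Pgrp"
  obtains h where "h \<in> Pgrp" "g ** h = mat 1" "h ** g = mat 1"
proof -
  have m1: "(mat 1 :: 'a mat2) = mat22 1 0 0 1"
    by (simp add: vec_eq_iff mat_def forall_2)
  from assms show ?thesis
  proof (cases rule: Pgrp_cases)
    case (diag a b)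
    then show ?thesis
      by (intro that [of "mat22 (kconj a) 0 0 (kconj b)"])
         (simp_all add: m1 mat22_mult kconj_mult_self kconj_self_mult Pgrp_intros)
  next
    case (antidiag a b)
    then show ?thesis
      by (intro that [of "mat22 0 (kconj b) (kconj a) 0"])
         (simp_all add: m1 mat22_mult kconj_mult_self kconj_self_mult Pgrp_intros)
  qed
qed

lemma fibre_act_one [simp]: "fibre_act (mat 1) k = k"
  by (simp add: fibre_act_def mat_def)

lemma zero_section_frame_orbit: "zero_section (frame_orbit f) = assoc_class (f, 0)"
proof -
  have "fibre_act g k = 0 \<longleftrightarrow> k = 0" if "g \<in> Pgrp" for g :: "'a mat2" and k
    using that by (metis norm_eq_zero norm_fibre_act)
  then show ?thesis
    by (auto simp: zero_section_def frame_orbit_def assoc_class_def)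
qed

lemma line_mult:
  assumes "norm a = 1"
  shows "line (\<lambda>i. u i * a) = line u"
proof -
  have "\<exists>c. (\<lambda>i. u i * b) = (\<lambda>i. u i * a * c) \<and> norm c = 1" if "norm b = 1" for b
  proof (intro exI conjI)
    have "u i * a * (kconj a * b) = u i * (a * kconj a) * b" for i
      by (simp only: mult.assoc)
    then show "(\<lambda>i. u i * b) = (\<lambda>i. u i * a * (kconj a * b))"
      using assms by (simp add: kconj_self_mult)
    show "norm (kconj a * b) = 1"
      using assms that by (simp add: norm_mult)
  qed
  moreover have "\<exists>c. (\<lambda>i. u i * a * b) = (\<lambda>i. u i * c) \<and> norm c = 1" if "norm b = 1" for b
    using that assms by (intro exI [of _ "a * b"]) (simp add: norm_mult mult.assoc)
  ultimately show ?thesis unfolding line_def by blast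
qed

lemma line_pair_frame_act: "g \<in> Pgrp \<Longrightarrow> line_pair (frame_act f g) = line_pair f"
  by (erule Pgrp_cases) (simp_all add: line_pair_def frame_act_def line_mult)

lemma Gamma_incl_frame_orbit: "Gamma_incl (frame_orbit f) = line_pair f"
proof -
  have "line_pair ` frame_orbit f = {line_pair f}"
  proof
    show "line_pair ` frame_orbit f \<subseteq> {line_pair f}"
      by (auto simp: frame_orbit_def line_pair_frame_act)
    have "frame_act f (mat 1) \<in> frame_orbit f"
      using Pgrp_one unfolding frame_orbit_def by blast
    then show "{line_pair f} \<subseteq> line_pair ` frame_orbit f"
      using line_pair_frame_act [OF Pgrp_one, of f] by (metis empty_subsetI imageI insert_subset)
  qed
  then show ?thesis by (simp add: Gamma_incl_def)
qed

lemma radial_assoc_class: "radial t (assoc_class (f, k)) = assoc_class (f, (1 - t) *\<^sub>R k)"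
proof (rule set_eqI)
  fix p
  have "\<exists>k'. fibre_act g k' = k \<and> k'' = (1 - t) *\<^sub>R k'"
    if "g \<in> Pgrp" "fibre_act g k'' = (1 - t) *\<^sub>R k" for g k''
  proof -
    obtain h where h: "h \<in> Pgrp" "g ** h = mat 1" "h ** g = mat 1"
      using Pgrp_inverse [OF \<open>g \<in> Pgrp\<close>] by blast
    have "fibre_act g (fibre_act h k) = k"
      using h that by (metis fibre_act_mult fibre_act_one)
    moreover have "k'' = (1 - t) *\<^sub>R fibre_act h k"
      using h that by (metis fibre_act_mult fibre_act_one fibre_act_scaleR)
    ultimately show ?thesis by blast
  qed
  then show "p \<in> radial t (assoc_class (f, k)) \<longleftrightarrow> p \<in> assoc_class (f, (1 - t) *\<^sub>R k)"
    unfolding radial_def assoc_class_def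
    by (cases p) (auto simp: fibre_act_scaleR image_iff, metis)
qed

end

theory Submission
  imports Defs
begin

text \<open>Two orthogonal lines, spanned by an orthonormal frame \<open>(u, v)\<close>, can be bent towards each
  other by a scalar \<open>k\<close> with \<open>|k| < 1\<close>: replace them by the lines spanned by \<open>u + v k\<^sup>*\<close> and
  \<open>v + u k\<close>, where \<open>k\<^sup>*\<close> is the conjugate of \<open>k\<close>. Both vectors have squared norm \<open>1 + |k|\<^sup>2\<close>, and
  after normalisation (\<open>bend\<close>) their hermitian product is \<open>s = 2 k / (1 + |k|\<^sup>2)\<close>, of norm less than
  1, so that the two lines are distinct. The map \<open>k \<mapsto> s\<close> is a homeomorphism of the open unit disc,
  with inverse \<open>s \<mapsto> s / (1 + sqrt (1 - |s|\<^sup>2))\<close>, and once \<open>k\<close> is known the frame is recovered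
  linearly from the bent vectors, since \<open>(u + v k\<^sup>*) - (v + u k) k\<^sup>* = (1 - |k|\<^sup>2) u\<close>. Hence
  bending is a homeomorphism from \<open>V\<^bsub>n+1,2\<^esub> \<times> D\<^sub>o\<close> onto the space of pairs of unit vectors spanning
  distinct lines (\<open>homeomorphic_map_bend\<close>).

  Bending is equivariant: bending the frame \<open>f g\<close> by \<open>k\<close> gives the same as bending \<open>f\<close> by
  \<open>g \<cdot> k\<close> and then applying \<open>g\<close> (\<open>bend_frame_act\<close>). This is where the action of \<open>P\<^sup>d\<close> on the fibre
  comes from. Two pairs of unit vectors give the same unordered pair of lines exactly when they differ
  by an element of \<open>P\<^sup>d\<close>. So bending induces a bijection from the disc bundle to the unordered pairs of
  distinct lines. It is a homeomorphism because both sides carry quotient topologies. On the right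
  this uses that the orbit map of the unit scalars on the sphere is open, so that its square is
  again a quotient map, and that the diagonal is removed from the symmetric square by restricting to
  an open set (\<open>quotient_map_distinct_pairs\<close>).

  For \<open>n = \<infinity>\<close> the maps of the finite stages fit together to one injective map. A
  colimit of homeomorphisms is a homeomorphism, and removing the diagonal commutes with the colimit
  because its complement is open at every stage. The homotopy is the radial contraction of the
  disc bundle, transported by this homeomorphism. Its continuity needs that the product with the
  locally compact space \<open>[0, 1]\<close> preserves quotient maps and colimits; the second fact is the tube lemma
  (\<open>continuous_map_prod_up_to_infinity\<close>).\<close>

section \<open>The hermitian form\<close>

lemma kconj_minus: "kconj (- x) = - kconj (x :: 'k::conj_division_algebra)"
  using kconj_scaleR [of "-1" x] by simp

lemma kconj_diff: "kconj (x - y) = kconj x - kconj (y :: 'k::conj_division_algebra)"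
  using kconj_add [of x "- y"] by (simp add: kconj_minus)

lemma kconj_sum: "kconj (sum f A) = (\<Sum>i\<in>A. kconj (f i :: 'k::conj_division_algebra))"
  by (induction A rule: infinite_finite_induct) (simp_all add: kconj_add)

lemma bounded_linear_kconj: "bounded_linear (kconj :: 'k \<Rightarrow> 'k::conj_division_algebra)"
  by (rule bounded_linear_intro [where K = 1]) (simp_all add: kconj_add kconj_scaleR)

lemmas continuous_on_kconj [continuous_intros] =
  bounded_linear.continuous_on [OF bounded_linear_kconj]

lemma mult_kconj_cancel [simp]:
  fixes a b :: "'k::conj_division_algebra"
  assumes "norm a = 1"
  shows "kconj a * a = 1" "a * kconj a = 1" "b * kconj a * a = b" "b * a * kconj a = b"
  using assms by (simp_all add: kconj_mult_self kconj_self_mult mult.assoc)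

lemma mult_kconj_self [simp]:
  fixes a b :: "'k::conj_division_algebra"
  shows "b * kconj a * a = (norm a)\<^sup>2 *\<^sub>R b" "b * a * kconj a = (norm a)\<^sup>2 *\<^sub>R b"
  by (simp_all add: mult.assoc kconj_mult_self kconj_self_mult)
     (simp_all add: of_real_def)

lemma herm_add_left: "herm n (\<lambda>i. u i + v i) w = herm n u w + herm n v w"
  and herm_add_right: "herm n u (\<lambda>i. v i + w i) = herm n u v + herm n u w"
  and herm_diff_left: "herm n (\<lambda>i. u i - v i) w = herm n u w - herm n v w"
  and herm_diff_right: "herm n u (\<lambda>i. v i - w i) = herm n u v - herm n u w"
  by (simp_all add: herm_def kconj_add kconj_diff algebra_simps sum.distrib sum_subtractf)

lemma herm_mult_left: "herm n (\<lambda>i. u i * a) v = kconj a * herm n u v"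
  and herm_mult_right: "herm n u (\<lambda>i. v i * a) = herm n u v * a"
  by (simp_all add: herm_def kconj_mult sum_distrib_left sum_distrib_right mult.assoc)

lemma herm_scaleR_left: "herm n (\<lambda>i. r *\<^sub>R u i) v = r *\<^sub>R herm n u v"
  and herm_scaleR_right: "herm n u (\<lambda>i. r *\<^sub>R v i) = r *\<^sub>R herm n u v"
  by (simp_all add: herm_def kconj_scaleR scaleR_sum_right)

lemmas herm_linear = herm_add_left herm_add_right herm_diff_left herm_diff_right
  herm_mult_left herm_mult_right herm_scaleR_left herm_scaleR_right

lemma kconj_herm: "kconj (herm n u v) = herm n v u"
  by (simp add: herm_def kconj_sum kconj_mult)

lemma herm_self: "herm n u u = of_real (\<Sum>i\<le>n. (norm (u i))\<^sup>2)"
  by (simp add: herm_def kconj_mult_self)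

lemma herm_self_eq_0_iff:
  assumes "u \<in> Kvec n"
  shows "herm n u u = 0 \<longleftrightarrow> u = (\<lambda>i. 0)"
proof
  assume "herm n u u = 0"
  then have "(\<Sum>i\<le>n. (norm (u i))\<^sup>2) = 0"
    by (simp add: herm_self flip: of_real_sum of_real_power)
  then have "\<forall>i\<le>n. u i = 0"
    by (subst (asm) sum_nonneg_eq_0_iff) auto
  then show "u = (\<lambda>i. 0)"
    using assms by (metis (mono_tags, lifting) Kvec_def ext mem_Collect_eq not_le)
qed (simp add: herm_def)

lemma herm_Kvec_le:
  assumes "u \<in> Kvec n" "n \<le> N"
  shows "herm N u v = herm n u v"
  unfolding herm_def using assms
  by (intro sum.mono_neutral_right) (auto simp: Kvec_def)

lemma Kvec_mono: "n \<le> N \<Longrightarrow> Kvec n \<subseteq> Kvec N"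
  by (auto simp: Kvec_def)

lemma Stiefel_mono: "n \<le> N \<Longrightarrow> Stiefel n \<subseteq> Stiefel N"
  using Kvec_mono [of n N] by (auto simp: Stiefel_def herm_Kvec_le [of _ n N])

lemma continuous_on_herm [continuous_intros]:
  assumes "continuous_on S f" "continuous_on S g"
  shows "continuous_on S (\<lambda>p. herm n (f p) (g p))"
  unfolding herm_def
  by (intro continuous_intros continuous_on_product_then_coordinatewise [OF assms(1)]
      continuous_on_product_then_coordinatewise [OF assms(2)])

section \<open>Lines and pairs of lines\<close>

lemma line_eq_iff: "line x = line y \<longleftrightarrow> (\<exists>a. norm a = 1 \<and> y = (\<lambda>i. x i * a))"
proof
  assume "line x = line y"
  moreover have "y \<in> line y"
    unfolding line_def by (intro CollectI exI [of _ 1]) simp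
  ultimately show "\<exists>a. norm a = 1 \<and> y = (\<lambda>i. x i * a)"
    by (auto simp: line_def)
qed (auto simp: line_mult)

lemma Ksphere_mult:
  assumes "x \<in> Ksphere n" "norm a = 1"
  shows "(\<lambda>i. x i * a) \<in> Ksphere n"
  using assms by (simp add: Ksphere_def Kvec_def herm_linear)

text \<open>This is the Cauchy--Schwarz inequality with its case of equality. With \<open>s = herm n x y\<close>, the
  component \<open>z = y - x s\<close> of \<open>y\<close> orthogonal to \<open>x\<close> satisfies \<open>|z|\<^sup>2 = 1 - |s|\<^sup>2\<close>.\<close>

lemma line_eq_iff_norm_herm:
  assumes x: "x \<in> Ksphere n" and y: "y \<in> Ksphere n"
  shows "norm (herm n x y) \<le> 1" and "line x = line y \<longleftrightarrow> norm (herm n x y) = 1"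
proof -
  define s where "s = herm n x y"
  define z where "z = (\<lambda>i. y i - x i * s)"
  have yx: "herm n y x = kconj s"
    by (simp add: s_def kconj_herm)
  have z: "z \<in> Kvec n"
    using x y by (auto simp: z_def Ksphere_def Kvec_def)
  have "herm n z z = 1 - kconj s * s"
    using x y by (simp add: z_def herm_linear Ksphere_def yx s_def [symmetric] algebra_simps)
  then have zz: "herm n z z = of_real (1 - (norm s)\<^sup>2)"
    by (simp add: kconj_mult_self)
  then have eq: "1 - (norm s)\<^sup>2 = (\<Sum>i\<le>n. (norm (z i))\<^sup>2)"
    by (metis herm_self of_real_eq_iff)
  then have "(norm s)\<^sup>2 \<le> 1"
    by (smt (verit) sum_nonneg zero_le_power2)
  then show "norm (herm n x y) \<le> 1"
    by (simp add: s_def power_le_one_iff)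
  have "y = (\<lambda>i. x i * s)" if "norm s = 1"
  proof -
    have "herm n z z = 0" using zz that by simp
    then have "z = (\<lambda>i. 0)" using herm_self_eq_0_iff [OF z] by simp
    then show ?thesis by (auto simp: z_def fun_eq_iff)
  qed
  moreover have "norm s = 1" if "norm a = 1" "y = (\<lambda>i. x i * a)" for a
    using that x by (simp add: s_def herm_linear Ksphere_def)
  ultimately show "line x = line y \<longleftrightarrow> norm (herm n x y) = 1"
    by (auto simp: line_eq_iff s_def)
qed

text \<open>An unordered pair of lines forgets the order of two unit vectors and their phases, which are
  the antidiagonal and the diagonal elements of \<open>P\<^sup>d\<close>.\<close>

lemma line_pair_eq_iff:
  "line_pair F = line_pair F' \<longleftrightarrow> (\<exists>g\<in>Pgrp. F' = frame_act F g)"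
proof
  assume "line_pair F = line_pair F'"
  then consider "line (fst F) = line (fst F')" "line (snd F) = line (snd F')"
    | "line (fst F) = line (snd F')" "line (snd F) = line (fst F')"
    by (auto simp: line_pair_def)
  then show "\<exists>g\<in>Pgrp. F' = frame_act F g"
  proof cases
    case 1
    then obtain a b where "norm a = 1" "fst F' = (\<lambda>i. fst F i * a)"
      "norm b = 1" "snd F' = (\<lambda>i. snd F i * b)"
      unfolding line_eq_iff by blast
    then show ?thesis
      by (intro bexI [of _ "mat22 a 0 0 b"]) (simp_all add: frame_act_def prod_eq_iff Pgrp_intros)
  next
    case 2
    then obtain a b where "norm a = 1" "snd F' = (\<lambda>i. fst F i * a)"
      "norm b = 1" "fst F' = (\<lambda>i. snd F i * b)"
      unfolding line_eq_iff by blast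
    then show ?thesis
      by (intro bexI [of _ "mat22 0 a b 0"]) (simp_all add: frame_act_def prod_eq_iff Pgrp_intros)
  qed
qed (auto simp: line_pair_frame_act)

text \<open>Each scalar of norm 1 acts by a homeomorphism, and the saturation of an open set is the union of
  its translates. Openness, unlike being a quotient map, is inherited by products.\<close>

lemma open_map_line: "open_map (top_of_set (Ksphere n)) (KP_fin n) line"
  unfolding open_map_def
proof (intro allI impI)
  fix U :: "'a vec_seq set"
  assume U: "openin (top_of_set (Ksphere n)) U"
  let ?R = "\<lambda>a. {x \<in> Ksphere n. (\<lambda>i. x i * a) \<in> U}"
  have "openin (top_of_set (Ksphere n)) (?R a)" if "norm a = 1" for a
  proof -
    have "continuous_map (top_of_set (Ksphere n)) (top_of_set (Ksphere n)) (\<lambda>x i. x i * a)"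
      using that by (auto simp: Ksphere_mult intro!: continuous_intros
        continuous_on_product_then_coordinatewise [OF continuous_on_id])
    from openin_continuous_map_preimage [OF this U] show ?thesis by simp
  qed
  then have "openin (top_of_set (Ksphere n)) (\<Union>a\<in>{a. norm a = 1}. ?R a)"
    by blast
  moreover have "{x \<in> Ksphere n. line x \<in> line ` U} = (\<Union>a\<in>{a. norm a = 1}. ?R a)"
    by (fastforce simp: line_eq_iff image_iff)
  ultimately show "openin (KP_fin n) (line ` U)"
    using openin_imp_subset [OF U] by (auto simp: KP_fin_def openin_quotient_topology)
qed

lemma open_map_prod:
  assumes "open_map X X' f" "open_map Y Y' g"
  shows "open_map (prod_topology X Y) (prod_topology X' Y') (\<lambda>(x, y). (f x, g y))"
  unfolding open_map_def
proof (intro allI impI)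
  fix W assume W: "openin (prod_topology X Y) W"
  show "openin (prod_topology X' Y') ((\<lambda>(x, y). (f x, g y)) ` W)"
    unfolding openin_prod_topology_alt
  proof (intro allI impI)
    fix a b assume "(a, b) \<in> (\<lambda>(x, y). (f x, g y)) ` W"
    then obtain x y where xy: "(x, y) \<in> W" "a = f x" "b = g y" by auto
    then obtain U V where "openin X U" "openin Y V" "x \<in> U" "y \<in> V" "U \<times> V \<subseteq> W"
      using W unfolding openin_prod_topology_alt by meson
    then show "\<exists>U V. openin X' U \<and> openin Y' V \<and> a \<in> U \<and> b \<in> V \<and>
        U \<times> V \<subseteq> (\<lambda>(x, y). (f x, g y)) ` W"
      using assms xy
      by (intro exI [of _ "f ` U"] exI [of _ "g ` V"]) (force simp: open_map_def)
  qed
qed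

abbreviation sphere_pairs :: "nat \<Rightarrow> ('k::conj_division_algebra) frame topology" where
  "sphere_pairs n \<equiv> prod_topology (top_of_set (Ksphere n)) (top_of_set (Ksphere n))"

lemma quotient_map_line_pair: 
  "quotient_map (sphere_pairs n) (SP2 (enat n)) (line_pair :: 'k::conj_division_algebra frame \<Rightarrow> _)"
proof -
  have q: "quotient_map (top_of_set (Ksphere n)) (KP_fin n) (line :: 'k vec_seq \<Rightarrow> _)"
    by (simp add: KP_fin_def quotient_map_quotient_topology)
  have "quotient_map (sphere_pairs n) (prod_topology (KP_fin n) (KP_fin n))
      (\<lambda>(x :: 'k vec_seq, y :: 'k vec_seq). (line x, line y))"
  proof (rule continuous_open_imp_quotient_map)
    show "continuous_map (sphere_pairs n) (prod_topology (KP_fin n) (KP_fin n))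
        (\<lambda>(x :: 'k vec_seq, y :: 'k vec_seq). (line x, line y))"
      using quotient_imp_continuous_map [OF q] continuous_map_prod_top by blast
    show "open_map (sphere_pairs n) (prod_topology (KP_fin n) (KP_fin n))
        (\<lambda>(x :: 'k vec_seq, y :: 'k vec_seq). (line x, line y))"
      by (intro open_map_prod open_map_line)
  qed (auto simp: KP_fin_def)
  then have "quotient_map (sphere_pairs n) (SP2 (enat n))
      ((\<lambda>(x, y). Upair x y) \<circ> (\<lambda>(x :: 'k vec_seq, y :: 'k vec_seq). (line x, line y)))"
    unfolding SP2_def up_to_infinity_def symmetric_square_def
    by (auto intro: quotient_map_compose quotient_map_quotient_topology)
  moreover have "(\<lambda>(x, y). Upair x y) \<circ> (\<lambda>(x :: 'k vec_seq, y :: 'k vec_seq). (line x, line y)) = line_pair"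
    by (auto simp: line_pair_def)
  ultimately show ?thesis by simp
qed

text \<open>By \<open>line_eq_iff_norm_herm\<close>, these are the pairs of unit vectors that span distinct lines. The
  condition on the hermitian product makes it visible that they form an open set.\<close>

definition distinct_pairs :: "nat \<Rightarrow> ('k::conj_division_algebra) frame set" where
  "distinct_pairs n = {(x, y). x \<in> Ksphere n \<and> y \<in> Ksphere n \<and> norm (herm n x y) < 1}"

text \<open>The two facts are proved together because a quotient map restricts to a quotient map over an
  open subset of the target.\<close>

lemma openin_SP2_minus_diagonal:
  "openin (SP2 (enat n)) (topspace (SP2 (enat n)) - diagonal (enat n)
     :: 'k::conj_division_algebra line uprod set)" (is ?open)
  and quotient_map_distinct_pairs:
  "quotient_map (top_of_set (distinct_pairs n :: 'k::conj_division_algebra frame set))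
     (SP2_minus_diagonal (enat n)) line_pair" (is ?quot)
proof -
  let ?V = "topspace (SP2 (enat n)) - diagonal (enat n) :: 'k line uprod set"
  have top: "topspace (SP2 (enat n)) = line_pair ` (Ksphere n \<times> Ksphere n :: 'k frame set)"
    using quotient_imp_surjective_map [OF quotient_map_line_pair [of n, where ?'k = 'k]] by simp
  have *: "line_pair p \<in> diagonal (enat n) \<longleftrightarrow> line (fst p) = line (snd p)"
    if "p \<in> Ksphere n \<times> Ksphere n" for p :: "'k frame"
    using that
    by (auto simp: diagonal_def line_pair_def KP_def up_to_infinity_def KP_fin_def)
  have pre: "{p \<in> topspace (sphere_pairs n). line_pair p \<in> ?V} = distinct_pairs n"
  proof (rule set_eqI)
    fix p :: "'k frame"
    show "p \<in> {p \<in> topspace (sphere_pairs n). line_pair p \<in> ?V} \<longleftrightarrow> p \<in> distinct_pairs n"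
    proof (cases "p \<in> Ksphere n \<times> Ksphere n")
      case True
      then have "norm (herm n (fst p) (snd p)) < 1 \<longleftrightarrow> line (fst p) \<noteq> line (snd p)"
        using line_eq_iff_norm_herm [of "fst p" n "snd p"] by (auto simp: less_le)
      moreover have "line_pair p \<in> topspace (SP2 (enat n))"
        unfolding top using True by (rule imageI)
      ultimately show ?thesis
        using True * [OF True] by (auto simp: distinct_pairs_def)
    next
      case False
      then show ?thesis by (auto simp: distinct_pairs_def)
    qed
  qed
  have "openin (top_of_set (Ksphere n \<times> Ksphere n))
      ((Ksphere n \<times> Ksphere n) \<inter> (\<lambda>p :: 'k frame. norm (herm n (fst p) (snd p))) -` {..<1})"
    by (intro continuous_openin_preimage_gen continuous_intros)
  moreover have "(Ksphere n \<times> Ksphere n) \<inter> (\<lambda>p :: 'k frame. norm (herm n (fst p) (snd p))) -` {..<1}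
      = distinct_pairs n"
    by (auto simp: distinct_pairs_def)
  ultimately have "openin (sphere_pairs n) (distinct_pairs n :: 'k frame set)"
    by simp
  then have "openin (sphere_pairs n) {p \<in> topspace (sphere_pairs n). line_pair p \<in> ?V}"
    by (simp only: pre)
  moreover have "openin (sphere_pairs n) {p \<in> topspace (sphere_pairs n). line_pair p \<in> U} \<longleftrightarrow>
      openin (SP2 (enat n)) U" if "U \<subseteq> topspace (SP2 (enat n))" for U :: "'k line uprod set"
    using quotient_map_line_pair [of n, where ?'k = 'k] that
    unfolding quotient_map_def by blast
  ultimately show open_V: ?open
    by blast
  have "distinct_pairs n \<subseteq> Ksphere n \<times> (Ksphere n :: 'k vec_seq set)"
    by (auto simp: distinct_pairs_def)
  then have "top_of_set (distinct_pairs n) = subtopology (sphere_pairs n) (distinct_pairs n :: 'k frame set)"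
    by (simp add: subtopology_subtopology inf_absorb2)
  then show ?quot
    unfolding SP2_minus_diagonal_def
    using quotient_map_restriction [OF quotient_map_line_pair pre disjI1 [OF open_V]] by simp
qed

section \<open>Bending orthonormal frames\<close>

definition bend :: "('k::conj_division_algebra) frame \<times> 'k \<Rightarrow> 'k frame" where
  "bend = (\<lambda>((u, v), k).
     let c = 1 / sqrt (1 + (norm k)\<^sup>2)
     in (\<lambda>i. c *\<^sub>R (u i + v i * kconj k), \<lambda>i. c *\<^sub>R (v i + u i * k)))"

text \<open>The inverse of \<open>bend\<close>: \<open>k\<close> solves \<open>s = 2 k / (1 + |k|\<^sup>2)\<close> with \<open>|k| < 1\<close>, and the linear system for
  \<open>u\<close> and \<open>v\<close> has determinant \<open>1 - |k|\<^sup>2\<close>.\<close>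

definition unbend :: "nat \<Rightarrow> ('k::conj_division_algebra) frame \<Rightarrow> 'k frame \<times> 'k" where
  "unbend n = (\<lambda>(x, y).
     let s = herm n x y;
         k = (1 / (1 + sqrt (1 - (norm s)\<^sup>2))) *\<^sub>R s;
         r = sqrt (1 + (norm k)\<^sup>2) / (1 - (norm k)\<^sup>2)
     in ((\<lambda>i. r *\<^sub>R (x i - y i * kconj k), \<lambda>i. r *\<^sub>R (y i - x i * k)), k))"

lemma frame_act_one: "frame_act f (mat 1) = f"
  by (simp add: frame_act_def mat_def)

text \<open>For \<open>g\<close> diagonal with entries \<open>a, b\<close>, this is
  \<open>u a + v b k\<^sup>* = (u + v (a k b\<^sup>*)\<^sup>*) a\<close>, and for \<open>g\<close> antidiagonal the two vectors trade places, which
  conjugates \<open>k\<close>.\<close>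

lemma bend_frame_act:
  assumes "g \<in> Pgrp"
  shows "bend (frame_act f g, k) = frame_act (bend (f, fibre_act g k)) g"
  using assms
proof (cases rule: Pgrp_cases)
  case (diag a b)
  then show ?thesis
    by (cases f)
       (auto simp: bend_def Let_def frame_act_def fibre_act_def kconj_mult norm_mult fun_eq_iff
         distrib_right mult.assoc [symmetric] simp del: mult_kconj_self)
next
  case (antidiag a b)
  then show ?thesis
    by (cases f)
       (auto simp: bend_def Let_def frame_act_def fibre_act_def kconj_mult norm_mult fun_eq_iff
         distrib_right mult.assoc [symmetric] simp del: mult_kconj_self)
qed

lemma one_plus_norm_sq: "1 + (norm k)\<^sup>2 > 0" "sqrt (1 + (norm k)\<^sup>2) > 0"
  by (simp_all add: add_pos_nonneg)

lemma herm_bend: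
  assumes "f \<in> Stiefel n" and "bend (f, k) = (x, y)"
  shows "herm n x y = (2 / (1 + (norm k)\<^sup>2)) *\<^sub>R k" "herm n x x = 1" "herm n y y = 1"
proof -
  define c where "c = 1 / sqrt (1 + (norm k)\<^sup>2)"
  have cc: "c * c = 1 / (1 + (norm k)\<^sup>2)"
    using one_plus_norm_sq [of k] by (simp add: c_def)
  obtain u v where f: "f = (u, v)" by (cases f)
  have x: "x = (\<lambda>i. c *\<^sub>R (u i + v i * kconj k))" and y: "y = (\<lambda>i. c *\<^sub>R (v i + u i * k))"
    using assms(2) by (simp_all add: bend_def f Let_def c_def)
  have h: "herm n u u = 1" "herm n v v = 1" "herm n u v = 0" "herm n v u = 0"
    using assms(1) kconj_herm [of n u v] by (simp_all add: Stiefel_def f)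
  have "herm n x y = (c * c) *\<^sub>R (k + k)"
    by (simp add: x y herm_linear h scaleR_add_right)
  then show "herm n x y = (2 / (1 + (norm k)\<^sup>2)) *\<^sub>R k"
    by (simp add: cc flip: scaleR_2)
  have "herm n x x = (c * c) *\<^sub>R (1 + k * kconj k)" "herm n y y = (c * c) *\<^sub>R (1 + kconj k * k)"
    by (simp_all add: x y herm_linear h scaleR_add_right)
  moreover have "1 + of_real ((norm k)\<^sup>2) = ((1 + (norm k)\<^sup>2) *\<^sub>R 1 :: 'a)"
    by (simp add: scaleR_left_distrib of_real_def)
  ultimately show "herm n x x = 1" "herm n y y = 1"
    using one_plus_norm_sq [of k] by (simp_all add: kconj_mult_self kconj_self_mult cc)
qed

lemma distinct_pairs_bend:
  assumes "f \<in> Stiefel n" "norm k < 1"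
  shows "bend (f, k) \<in> distinct_pairs n"
proof -
  obtain x y where xy: "bend (f, k) = (x, y)" by (cases "bend (f, k)")
  obtain u v where f: "f = (u, v)" by (cases f)
  have "x \<in> Kvec n" "y \<in> Kvec n"
    using assms(1) xy by (auto simp: f Stiefel_def Kvec_def bend_def Let_def)
  moreover have "norm (herm n x y) < 1"
  proof -
    \<comment> \<open>The hermitian product of the bent vectors has norm \<open>2 |k| / (1 + |k|\<^sup>2)\<close>.\<close>
    have "(norm k - 1)\<^sup>2 > 0" using assms(2) by simp
    then have "2 * norm k < 1 + (norm k)\<^sup>2" by (simp add: power2_eq_square algebra_simps)
    then show ?thesis
      using one_plus_norm_sq [of k] by (simp add: herm_bend(1) [OF assms(1) xy])
  qed
  ultimately show ?thesis
    using herm_bend [OF assms(1) xy] by (simp add: xy distinct_pairs_def Ksphere_def)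
qed

text \<open>Here \<open>1 - |s|\<^sup>2\<close> is the square of \<open>(1 - |k|\<^sup>2) / (1 + |k|\<^sup>2)\<close>, so the square root in \<open>unbend\<close>
  is rational in \<open>|k|\<^sup>2\<close>.\<close>

lemma unbend_bend:
  assumes "f \<in> Stiefel n" "norm k < 1"
  shows "unbend n (bend (f, k)) = (f, k)"
proof -
  obtain u v where f: "f = (u, v)" by (cases f)
  obtain x y where xy: "bend (f, k) = (x, y)" by (cases "bend (f, k)")
  define q where "q = (norm k)\<^sup>2"
  define c where "c = 1 / sqrt (1 + q)"
  have q: "0 \<le> q" "q < 1"
    using assms(2) by (simp_all add: q_def abs_square_less_1)
  have x: "x = (\<lambda>i. c *\<^sub>R (u i + v i * kconj k))" and y: "y = (\<lambda>i. c *\<^sub>R (v i + u i * k))"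
    using xy by (simp_all add: bend_def f Let_def c_def q_def)
  define s where "s = herm n x y"
  have s: "s = (2 / (1 + q)) *\<^sub>R k"
    using herm_bend(1) [OF assms(1) xy] by (simp add: q_def s_def)
  have ns: "(norm s)\<^sup>2 = (2 / (1 + q))\<^sup>2 * q"
    by (simp add: s q_def power_mult_distrib power_divide)
  have "1 - (norm s)\<^sup>2 = ((1 - q) / (1 + q))\<^sup>2"
    using q unfolding ns by (simp add: divide_simps) (simp add: power2_eq_square algebra_simps)
  then have "sqrt (1 - (norm s)\<^sup>2) = (1 - q) / (1 + q)"
    using q by simp
  then have "1 + sqrt (1 - (norm s)\<^sup>2) = 2 / (1 + q)"
    using q by (simp add: add_divide_distrib diff_divide_distrib) (simp add: divide_simps)
  then have "(1 / (1 + sqrt (1 - (norm s)\<^sup>2))) *\<^sub>R s = (1 / (2 / (1 + q)) * (2 / (1 + q))) *\<^sub>R k"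
    by (simp only: s scaleR_scaleR)
  then have k: "(1 / (1 + sqrt (1 - (norm s)\<^sup>2))) *\<^sub>R s = k"
    using q by (simp add: field_simps)
  have "u i = (sqrt (1 + q) / (1 - q)) *\<^sub>R (x i - y i * kconj k)"
    "v i = (sqrt (1 + q) / (1 - q)) *\<^sub>R (y i - x i * k)" for i
  proof -
    have "x i - y i * kconj k = (c * (1 - q)) *\<^sub>R u i" "y i - x i * k = (c * (1 - q)) *\<^sub>R v i"
      by (simp_all add: x y algebra_simps kconj_mult_self kconj_self_mult of_real_def flip: q_def)
    moreover have "sqrt (1 + q) / (1 - q) * (c * (1 - q)) = 1"
      using q by (simp add: c_def)
    ultimately show "u i = (sqrt (1 + q) / (1 - q)) *\<^sub>R (x i - y i * kconj k)"
      "v i = (sqrt (1 + q) / (1 - q)) *\<^sub>R (y i - x i * k)"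
      by (metis scaleR_scaleR scaleR_one)+
  qed
  then have "unbend n (x, y) = ((u, v), k)"
    by (simp only: unbend_def Let_def prod.case s_def [symmetric] k q_def [symmetric])
       (simp add: fun_eq_iff)
  then show ?thesis
    by (simp only: f xy [unfolded f])
qed

text \<open>With \<open>w = sqrt (1 - |s|\<^sup>2)\<close> and \<open>k = s / (1 + w)\<close>, one finds \<open>|k|\<^sup>2 = (1 - w) / (1 + w)\<close>, which
  gives back \<open>s = 2 k / (1 + |k|\<^sup>2)\<close>. From here on everything is expressed through \<open>k\<close> and \<open>q = |k|\<^sup>2\<close>.\<close>

lemma unbend:
  assumes "p \<in> distinct_pairs n"
  shows bend_unbend: "bend (unbend n p) = p"
    and unbend_mem: "unbend n p \<in> Stiefel n \<times> ball 0 1"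
proof -
  obtain x y where p: "p = (x, y)" by (cases p)
  define s where "s = herm n x y"
  have hyp: "x \<in> Kvec n" "y \<in> Kvec n" "herm n x x = 1" "herm n y y = 1" "norm s < 1"
    using assms by (simp_all add: p distinct_pairs_def Ksphere_def s_def)
  have yx: "herm n y x = kconj s"
    by (simp add: s_def kconj_herm)
  define w where "w = sqrt (1 - (norm s)\<^sup>2)"
  have ns: "(norm s)\<^sup>2 < 1" using hyp(5) by (simp add: abs_square_less_1)
  then have w: "w > 0" "w\<^sup>2 = 1 - (norm s)\<^sup>2"
    by (simp_all add: w_def)
  define k where "k = (1 / (1 + w)) *\<^sub>R s"
  define q where "q = (norm k)\<^sup>2"
  have "norm k \<le> norm s"
    using w(1) by (simp add: k_def divide_le_eq mult_le_cancel_left1 algebra_simps)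
  then have nk: "norm k < 1" using hyp(5) by simp
  then have q: "0 \<le> q" "q < 1" by (simp_all add: q_def abs_square_less_1)
  have "q = (1 - w\<^sup>2) / (1 + w)\<^sup>2"
    using w by (simp add: q_def k_def power_divide)
  also have "\<dots> = (1 - w) / (1 + w)"
    using w(1) by (simp add: divide_simps power2_eq_square) (simp add: algebra_simps)
  finally have qw: "q = (1 - w) / (1 + w)" .
  have "(1 + w) * (1 + q) = 2"
    using w(1) by (simp add: qw divide_simps)
  then have s: "s = (2 / (1 + q)) *\<^sub>R k"
    using w(1) q by (simp add: k_def field_simps)
  define r where "r = sqrt (1 + q) / (1 - q)"
  have r: "r > 0" "r\<^sup>2 = (1 + q) / (1 - q)\<^sup>2"
    using q by (simp_all add: r_def power_divide)
  define u where "u = (\<lambda>i. r *\<^sub>R (x i - y i * kconj k))"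
  define v where "v = (\<lambda>i. r *\<^sub>R (y i - x i * k))"
  have ub: "unbend n p = ((u, v), k)"
    by (simp add: unbend_def p Let_def u_def v_def r_def q_def k_def w_def flip: s_def)
  have kk: "k * kconj k = q *\<^sub>R 1" "kconj k * k = q *\<^sub>R 1"
    by (simp_all add: kconj_mult_self kconj_self_mult q_def of_real_def)
  \<comment> \<open>Both \<open>herm n u u\<close> and \<open>herm n v v\<close> will turn out to be this multiple of 1.\<close>
  have one: "r * r * (1 - 2 * (2 / (1 + q) * q) + q) = 1"
  proof -
    have "1 - 2 * (2 / (1 + q) * q) + q = (1 - q)\<^sup>2 / (1 + q)"
      using q by (simp add: divide_simps) (simp add: power2_eq_square algebra_simps)
    then show ?thesis using r q by (simp add: power2_eq_square)
  qed
  have "herm n u u = (r * r) *\<^sub>R (1 - s * kconj k - k * kconj s + k * kconj k)"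
    "herm n v v = (r * r) *\<^sub>R (1 - kconj s * k - kconj k * s + kconj k * k)"
    by (simp_all add: u_def v_def herm_linear hyp yx algebra_simps flip: s_def)
  then have "herm n u u = (r * r * (1 - 2 * (2 / (1 + q) * q) + q)) *\<^sub>R 1"
    "herm n v v = (r * r * (1 - 2 * (2 / (1 + q) * q) + q)) *\<^sub>R 1"
    by (simp_all add: s kconj_scaleR kk algebra_simps flip: scaleR_2 q_def)
  moreover have "herm n u v = 0"
  proof -
    have "herm n u v = (r * r) *\<^sub>R (s - k - k + k * kconj s * k)"
      by (simp add: u_def v_def herm_linear hyp yx algebra_simps flip: s_def)
    also have "s - k - k + k * kconj s * k = (2 / (1 + q) - 2 + 2 / (1 + q) * q) *\<^sub>R k"
      by (simp add: s kconj_scaleR scaleR_2 scaleR_left_distrib scaleR_left_diff_distrib kk)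
    also have "2 / (1 + q) - 2 + 2 / (1 + q) * q = 0"
      using q by (simp add: divide_simps)
    finally show ?thesis by simp
  qed
  moreover have "u \<in> Kvec n" "v \<in> Kvec n"
    using hyp by (simp_all add: u_def v_def Kvec_def)
  ultimately show "unbend n p \<in> Stiefel n \<times> ball 0 1"
    using nk one by (simp add: ub Stiefel_def)
  have "(1 / sqrt (1 + q)) *\<^sub>R (u i + v i * kconj k) = x i"
    "(1 / sqrt (1 + q)) *\<^sub>R (v i + u i * k) = y i" for i
  proof -
    have "u i + v i * kconj k = (r * (1 - q)) *\<^sub>R x i" "v i + u i * k = (r * (1 - q)) *\<^sub>R y i"
      by (simp_all add: u_def v_def algebra_simps kk)
    moreover have "1 / sqrt (1 + q) * (r * (1 - q)) = 1"
      using q by (simp add: r_def)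
    ultimately show "(1 / sqrt (1 + q)) *\<^sub>R (u i + v i * kconj k) = x i"
      "(1 / sqrt (1 + q)) *\<^sub>R (v i + u i * k) = y i"
      by (metis scaleR_scaleR scaleR_one)+
  qed
  then show "bend (unbend n p) = p"
    unfolding ub by (simp add: bend_def p Let_def flip: q_def)
qed

lemma continuous_on_frame_coordinates [continuous_intros]:
  fixes f :: "'a::topological_space \<Rightarrow> ('k::conj_division_algebra) frame"
  assumes "continuous_on S f"
  shows "continuous_on S (\<lambda>p. fst (f p) i)" "continuous_on S (\<lambda>p. snd (f p) i)"
  using assms by (auto intro: continuous_on_product_then_coordinatewise continuous_on_fst continuous_on_snd)

lemma continuous_on_bend: "continuous_on S bend"
proof -
  have [simp]: "1 + (norm k)\<^sup>2 \<noteq> 0" for k :: 'a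
    using one_plus_norm_sq(1) [of k] by simp
  show ?thesis
    unfolding bend_def Let_def split_def
    by (intro continuous_intros) auto
qed

lemma continuous_on_unbend: "continuous_on (distinct_pairs n) (unbend n)"
proof -
  define k where "k p =
    (1 / (1 + sqrt (1 - (norm (herm n (fst p) (snd p)))\<^sup>2))) *\<^sub>R herm n (fst p) (snd p)"
    for p :: "'a frame"
  have unbend_k: "unbend n =
      (\<lambda>p. ((\<lambda>i. (sqrt (1 + (norm (k p))\<^sup>2) / (1 - (norm (k p))\<^sup>2)) *\<^sub>R (fst p i - snd p i * kconj (k p)),
            \<lambda>i. (sqrt (1 + (norm (k p))\<^sup>2) / (1 - (norm (k p))\<^sup>2)) *\<^sub>R (snd p i - fst p i * k p)), k p))"
    by (simp add: unbend_def k_def Let_def split_def)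
  have "1 + sqrt (1 - (norm (herm n (fst p) (snd p)))\<^sup>2) \<noteq> 0" if "p \<in> distinct_pairs n" for p
  proof -
    have "(norm (herm n (fst p) (snd p)))\<^sup>2 < 1"
      using that by (auto simp: distinct_pairs_def abs_square_less_1)
    then have "sqrt (1 - (norm (herm n (fst p) (snd p)))\<^sup>2) \<ge> 0" by simp
    then show ?thesis by linarith
  qed
  then have k: "continuous_on (distinct_pairs n) k"
    unfolding k_def by (intro continuous_intros) auto
  have "1 - (norm (k p))\<^sup>2 \<noteq> 0" if "p \<in> distinct_pairs n" for p
  proof -
    have "norm (k p) < 1"
      using unbend_mem [OF that] by (simp add: unbend_k)
    then have "(norm (k p))\<^sup>2 < 1" by (simp add: abs_square_less_1)
    then show ?thesis by linarith
  qed
  then show ?thesis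
    unfolding unbend_k by (intro continuous_intros k) auto
qed

lemma homeomorphic_map_bend:
  "homeomorphic_map (top_of_set (Stiefel n \<times> ball 0 1)) (top_of_set (distinct_pairs n)) bend"
proof (rule homeomorphic_maps_imp_map [where g = "unbend n"])
  show "homeomorphic_maps (top_of_set (Stiefel n \<times> ball 0 1)) (top_of_set (distinct_pairs n))
      bend (unbend n)"
    using unbend_mem distinct_pairs_bend unbend_bend
    by (fastforce simp: homeomorphic_maps_def bend_unbend continuous_on_bend continuous_on_unbend)
qed

section \<open>The disc bundle and pairs of distinct lines\<close>

lemma Stiefel_frame_act:
  assumes "f \<in> Stiefel n" "g \<in> Pgrp"
  shows "frame_act f g \<in> Stiefel n"
proof -
  obtain u v where f: "f = (u, v)" by (cases f)
  have "herm n v u = 0"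
    using assms(1) kconj_herm [of n u v] by (simp add: f Stiefel_def)
  with assms(1) show ?thesis
    by (cases rule: Pgrp_cases [OF assms(2)])
       (simp_all add: f Stiefel_def frame_act_def Kvec_def herm_linear)
qed

lemma assoc_class_frame_act:
  assumes "g \<in> Pgrp"
  shows "assoc_class (frame_act f g, k) = assoc_class (f, fibre_act g k)"
proof -
  obtain g' where g': "g' \<in> Pgrp" "g ** g' = mat 1" "g' ** g = mat 1"
    using Pgrp_inverse [OF assms] by blast
  have sub: "assoc_class (frame_act f g, k) \<subseteq> assoc_class (f, fibre_act g k)"
    if "g \<in> Pgrp" for f :: "'a frame" and g k
  proof
    fix p assume "p \<in> assoc_class (frame_act f g, k)"
    then obtain h k' where "p = (frame_act (frame_act f g) h, k')" "h \<in> Pgrp" "fibre_act h k' = k"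
      by (auto simp: assoc_class_def)
    then show "p \<in> assoc_class (f, fibre_act g k)"
      using that unfolding assoc_class_def
      by (auto simp: fibre_act_mult frame_act_mult Pgrp_mult intro!: exI [of _ "g ** h"])
  qed
  have "frame_act (frame_act f g) g' = f" "fibre_act g' (fibre_act g k) = k"
    using g' assms
    by (simp_all add: frame_act_one flip: frame_act_mult fibre_act_mult)
  then show ?thesis
    using sub [OF assms, of f k] sub [OF g'(1), of "frame_act f g" "fibre_act g k"] by simp
qed

lemma line_pair_bend_frame_act:
  "g \<in> Pgrp \<Longrightarrow> line_pair (bend (frame_act f g, k)) = line_pair (bend (f, fibre_act g k))"
  by (simp add: bend_frame_act line_pair_frame_act)

text \<open>If the pairs of lines agree, the bent frames differ by some \<open>g\<close> in the group; equivariance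
  moves \<open>g\<close> inside \<open>bend\<close>, which is injective.\<close>

lemma line_pair_bend_eq_imp:
  assumes f: "f \<in> Stiefel n" "norm k < 1" and f': "f' \<in> Stiefel n" "norm k' < 1"
    and eq: "line_pair (bend (f, k)) = line_pair (bend (f', k'))"
  shows "assoc_class (f, k) = assoc_class (f', k')"
proof -
  obtain g where g: "g \<in> Pgrp" "bend (f', k') = frame_act (bend (f, k)) g"
    using eq by (auto simp: line_pair_eq_iff)
  obtain h where h: "h \<in> Pgrp" "g ** h = mat 1"
    using Pgrp_inverse [OF g(1)] by blast
  have gh: "fibre_act g (fibre_act h k) = k"
    using fibre_act_mult [OF g(1) h(1), of k] by (simp add: h(2))
  have "bend (f', k') = bend (frame_act f g, fibre_act h k)"
    by (simp add: g bend_frame_act gh)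
  then have "(f', k') = (frame_act f g, fibre_act h k)"
    using unbend_bend [OF f'] unbend_bend [OF Stiefel_frame_act [OF f(1) g(1)], of "fibre_act h k"]
      f(2) norm_fibre_act [OF h(1), of k] by metis
  then show ?thesis
    by (simp add: assoc_class_frame_act [OF g(1)] gh)
qed

text \<open>The homeomorphism of the theorem. It does not mention \<open>n\<close>, so the maps of all stages are
  restrictions of one function. By \<open>bent_lines_assoc_class\<close>, the image under \<open>the_elem\<close> below is a
  singleton.\<close>

definition bent_lines :: "(('k::conj_division_algebra) frame \<times> 'k) set \<Rightarrow> 'k line uprod" where
  "bent_lines E = the_elem ((\<lambda>p. line_pair (bend p)) ` E)"

lemma bent_lines_assoc_class: "bent_lines (assoc_class p) = line_pair (bend p)"
proof -
  have "p = (frame_act (fst p) (mat 1), snd p)"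
    by (simp add: frame_act_one)
  then have "p \<in> assoc_class p"
    unfolding assoc_class_def using Pgrp_one fibre_act_one by blast
  moreover have "line_pair (bend p') = line_pair (bend p)" if "p' \<in> assoc_class p" for p'
    using that by (auto simp: assoc_class_def line_pair_bend_frame_act)
  ultimately have "(\<lambda>p. line_pair (bend p)) ` assoc_class p = {line_pair (bend p)}"
    by blast
  then show ?thesis by (simp add: bent_lines_def)
qed

lemma quotient_map_assoc_class:
  "quotient_map (top_of_set (Stiefel n \<times> ball (0 :: 'k::conj_division_algebra) 1)) (Do_theta (enat n)) assoc_class"
  using quotient_map_quotient_topology
    [of "prod_topology (top_of_set (Stiefel n)) (top_of_set (ball 0 1))" assoc_class]
  by (simp add: Do_theta_def up_to_infinity_def assoc_bundle_def)

lemma topspace_Do_theta_enat: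
  "topspace (Do_theta (enat n)) =
     assoc_class ` (Stiefel n \<times> ball (0 :: 'k::conj_division_algebra) 1)"
  using quotient_imp_surjective_map [OF quotient_map_assoc_class [of n, where ?'k = 'k]] by simp

lemma topspace_up_to_infinity:
  "topspace (up_to_infinity X n) = (\<Union>m\<in>{m. n = enat m \<or> n = \<infinity>}. topspace (X m))"
  by (cases n) (auto simp: up_to_infinity_def)

lemma Do_theta_up_to_infinity: "Do_theta = up_to_infinity (\<lambda>m. Do_theta (enat m))"
  by (simp add: Do_theta_def up_to_infinity_def fun_eq_iff)

text \<open>Two frames in different stages are compared in the larger one.\<close>

lemma inj_on_bent_lines:
  "inj_on bent_lines (\<Union>n. topspace (Do_theta (enat n)))"
proof (rule inj_onI)
  fix E E' :: "('a frame \<times> 'a) set"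
  assume "E \<in> (\<Union>n. topspace (Do_theta (enat n)))" "E' \<in> (\<Union>n. topspace (Do_theta (enat n)))"
    and eq: "bent_lines E = bent_lines E'"
  then obtain n f k n' f' k' where E: "E = assoc_class (f, k)" "f \<in> Stiefel n" "norm k < 1"
    and E': "E' = assoc_class (f', k')" "f' \<in> Stiefel n'" "norm k' < 1"
    by (auto simp: topspace_Do_theta_enat)
  have "f \<in> Stiefel (max n n')" "f' \<in> Stiefel (max n n')"
    using E(2) E'(2) Stiefel_mono [of n "max n n'"] Stiefel_mono [of n' "max n n'"] by auto
  then show "E = E'"
    using line_pair_bend_eq_imp [of f "max n n'" k f' k'] E E' eq
    by (simp add: bent_lines_assoc_class)
qed

text \<open>The composite of \<open>bent_lines\<close> with the quotient map onto the disc bundle equals the quotient map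
  \<open>line_pair \<circ> bend\<close>. So \<open>bent_lines\<close> is itself a quotient map, and an injective one.\<close>

lemma homeomorphic_map_bent_lines_enat:
  "homeomorphic_map (Do_theta (enat n)) (SP2_minus_diagonal (enat n)) bent_lines"
proof -
  let ?X = "top_of_set (Stiefel n \<times> ball 0 1) :: ('a frame \<times> 'a) topology"
  have "quotient_map ?X (SP2_minus_diagonal (enat n)) (line_pair \<circ> bend)"
    using quotient_map_compose [OF _ quotient_map_distinct_pairs] homeomorphic_map_bend
    unfolding homeomorphic_map_def by blast
  moreover have "line_pair \<circ> bend = bent_lines \<circ> assoc_class"
    by (simp add: fun_eq_iff bent_lines_assoc_class)
  ultimately have "quotient_map (Do_theta (enat n)) (SP2_minus_diagonal (enat n))
      (bent_lines :: ('a frame \<times> 'a) set \<Rightarrow> _)"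
    using quotient_map_compose_eq [OF quotient_map_assoc_class [of n]] by metis
  moreover have "inj_on bent_lines (topspace (Do_theta (enat n)))"
    by (rule inj_on_subset [OF inj_on_bent_lines]) blast
  ultimately show ?thesis
    by (simp add: homeomorphic_map_def)
qed

section \<open>Passage to the colimit\<close>

text \<open>Injectivity on the whole union ensures that the preimage of each stage of \<open>Y\<close> is exactly the
  corresponding stage of \<open>X\<close>, so that openness can be tested stage by stage.\<close>

lemma homeomorphic_map_up_to_infinity:
  assumes hom: "\<And>i. homeomorphic_map (X i) (Y i) f"
    and inj: "inj_on f (\<Union>i. topspace (X i))"
  shows "homeomorphic_map (up_to_infinity X n) (up_to_infinity Y n) f"
proof (cases n)
  case (enat i)
  then show ?thesis using hom by (simp add: up_to_infinity_def)
next
  case infinity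
  have im: "f ` topspace (X i) = topspace (Y i)" for i
    using hom homeomorphic_imp_surjective_map by blast
  have "homeomorphic_map (colimit_topology X) (colimit_topology Y) f"
  proof (rule bijective_open_imp_homeomorphic_map)
    show "continuous_map (colimit_topology X) (colimit_topology Y) f"
      unfolding continuous_map
    proof (intro conjI allI impI)
      show "f ` topspace (colimit_topology X) \<subseteq> topspace (colimit_topology Y)"
        using im by auto
      fix U assume U: "openin (colimit_topology Y) U"
      have "{x \<in> (\<Union>i. topspace (X i)). f x \<in> U} \<inter> topspace (X i)
          = {x \<in> topspace (X i). f x \<in> U \<inter> topspace (Y i)}" for i
        using im by auto
      moreover have "openin (X i) {x \<in> topspace (X i). f x \<in> U \<inter> topspace (Y i)}" for i
        using U homeomorphic_imp_continuous_map [OF hom]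
        by (intro openin_continuous_map_preimage) (auto simp: openin_colimit_topology)
      ultimately show "openin (colimit_topology X) {x \<in> topspace (colimit_topology X). f x \<in> U}"
        by (auto simp: openin_colimit_topology)
    qed
    show "open_map (colimit_topology X) (colimit_topology Y) f"
      unfolding open_map_def
    proof (intro allI impI)
      fix U assume U: "openin (colimit_topology X) U"
      then have sub: "U \<subseteq> (\<Union>i. topspace (X i))"
        by (simp add: openin_colimit_topology)
      have "f ` U \<inter> topspace (Y i) = f ` (U \<inter> topspace (X i))" for i
        using inj_on_image_Int [OF inj sub, of "topspace (X i)"] im by auto
      moreover have "openin (Y i) (f ` (U \<inter> topspace (X i)))" for i
        using U homeomorphic_imp_open_map [OF hom, of i]
        by (auto simp: openin_colimit_topology open_map_def)
      moreover have "f ` U \<subseteq> (\<Union>i. topspace (Y i))"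
        using sub im by blast
      ultimately show "openin (colimit_topology Y) (f ` U)"
        by (simp add: openin_colimit_topology)
    qed
    show "f ` topspace (colimit_topology X) = topspace (colimit_topology Y)"
      using im by (simp add: image_UN)
  qed (use inj in auto)
  then show ?thesis by (simp add: infinity up_to_infinity_def)
qed

text \<open>The topology of the colimit is only known through its stages, so an open neighbourhood of a
  point \<open>x\<close> has to be described uniformly in the stage. Choose a compact neighbourhood \<open>K\<close> of the
  parameter \<open>t\<close> with \<open>K \<times> {x}\<close> in the preimage of the given open set. Then all points \<open>y\<close> with
  \<open>K \<times> {y}\<close> in this preimage form a set that is open in each stage by the tube lemma.\<close>

lemma continuous_map_prod_up_to_infinity:
  assumes T: "locally_compact_space T" "regular_space T"
    and f: "\<And>i. continuous_map (prod_topology T (X i)) (Y i) f"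
  shows "continuous_map (prod_topology T (up_to_infinity X n)) (up_to_infinity Y n) f"
proof (cases n)
  case (enat i)
  then show ?thesis using f by (simp add: up_to_infinity_def)
next
  case infinity
  have maps: "f (t, x) \<in> topspace (Y i)" if "t \<in> topspace T" "x \<in> topspace (X i)" for t x i
    using f [of i] that by (auto simp: continuous_map_def)
  have "continuous_map (prod_topology T (colimit_topology X)) (colimit_topology Y) f"
    unfolding continuous_map
  proof (intro conjI allI impI)
    show "f ` topspace (prod_topology T (colimit_topology X)) \<subseteq> topspace (colimit_topology Y)"
      using maps by auto
    fix W assume W: "openin (colimit_topology Y) W"
    let ?V = "{p \<in> topspace (prod_topology T (colimit_topology X)). f p \<in> W}"
    have pre: "openin (prod_topology T (X i)) {p \<in> topspace (prod_topology T (X i)). f p \<in> W}" for i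
    proof -
      have "openin (prod_topology T (X i))
          {p \<in> topspace (prod_topology T (X i)). f p \<in> W \<inter> topspace (Y i)}"
        using W by (intro openin_continuous_map_preimage [OF f]) (simp add: openin_colimit_topology)
      moreover have "{p \<in> topspace (prod_topology T (X i)). f p \<in> W \<inter> topspace (Y i)}
          = {p \<in> topspace (prod_topology T (X i)). f p \<in> W}"
        using maps by auto
      ultimately show ?thesis by simp
    qed
    show "openin (prod_topology T (colimit_topology X)) ?V"
      unfolding openin_prod_topology_alt
    proof (intro allI impI)
      fix t x assume tx: "(t, x) \<in> ?V"
      then obtain i where x: "x \<in> topspace (X i)" and t: "t \<in> topspace T" and "f (t, x) \<in> W"
        by auto
      have "continuous_map T (prod_topology T (X i)) (\<lambda>s. (s, x))"
        using x by (simp add: continuous_map_paired)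
      from openin_continuous_map_preimage [OF this pre]
      have "openin T {s \<in> topspace T. f (s, x) \<in> W}"
        using x by (simp cong: conj_cong)
      then obtain A K where A: "openin T A" "t \<in> A" "A \<subseteq> K"
        and K: "compactin T K" "K \<subseteq> {s \<in> topspace T. f (s, x) \<in> W}"
        using T t \<open>f (t, x) \<in> W\<close>
        by (force simp: locally_compact_space_neighbourhood_base neighbourhood_base_of)
      define B where "B = {y \<in> (\<Union>j. topspace (X j)). \<forall>s\<in>K. f (s, y) \<in> W}"
      have "openin (X j) (B \<inter> topspace (X j))" for j
      proof (subst openin_subopen, intro ballI)
        fix y assume y: "y \<in> B \<inter> topspace (X j)"
        have "K \<times> {y} \<subseteq> {p \<in> topspace (prod_topology T (X j)). f p \<in> W}"
          using y K by (auto simp: B_def)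
        then obtain C D where "openin T C" "openin (X j) D" "K \<subseteq> C" "y \<in> D"
          "C \<times> D \<subseteq> {p \<in> topspace (prod_topology T (X j)). f p \<in> W}"
          using tube_lemma_left [OF pre K(1), of y j] y by auto
        then show "\<exists>D. openin (X j) D \<and> y \<in> D \<and> D \<subseteq> B \<inter> topspace (X j)"
          using openin_subset [of "X j" D] by (intro exI [of _ D]) (auto simp: B_def)
      qed
      then have "openin (colimit_topology X) B"
        by (auto simp: openin_colimit_topology B_def)
      moreover have "x \<in> B"
        using x K by (auto simp: B_def)
      moreover have "A \<times> B \<subseteq> ?V"
        using A openin_subset [OF A(1)] by (auto simp: B_def)
      ultimately show "\<exists>U V. openin T U \<and> openin (colimit_topology X) V \<and> t \<in> U \<and> x \<in> V \<and> U \<times> V \<subseteq> ?V"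
        using A by blast
    qed
  qed
  then show ?thesis by (simp add: infinity up_to_infinity_def)
qed

lemma subtopology_colimit_topology:
  assumes "\<And>i. openin (X i) (S \<inter> topspace (X i))"
  shows "subtopology (colimit_topology X) S = colimit_topology (\<lambda>i. subtopology (X i) S)"
proof -
  let ?U = "\<Union>i. topspace (X i)"
  have "S \<inter> ?U \<inter> topspace (X i) = S \<inter> topspace (X i)" for i
    by blast
  then have "openin (colimit_topology X) (?U \<inter> S)"
    using assms by (simp add: openin_colimit_topology Int_commute)
  from openin_open_subtopology [OF this]
  have L: "openin (subtopology (colimit_topology X) S) V \<longleftrightarrow>
      openin (colimit_topology X) V \<and> V \<subseteq> ?U \<inter> S" for V
    by (metis subtopology_restrict topspace_colimit_topology)
  have R: "openin (subtopology (X i) S) V \<longleftrightarrow> openin (X i) V \<and> V \<subseteq> S" for i V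
    using openin_open_subtopology [OF assms [of i], of V] openin_subset [of "X i" V]
    by (metis Int_commute le_inf_iff subtopology_restrict)
  have "openin (subtopology (colimit_topology X) S) V \<longleftrightarrow>
      openin (colimit_topology (\<lambda>i. subtopology (X i) S)) V" for V
  proof (cases "V \<subseteq> ?U \<inter> S")
    case True
    then have "V \<inter> (topspace (X i) \<inter> S) = V \<inter> topspace (X i)" for i
      by blast
    then show ?thesis
      using True unfolding L openin_colimit_topology by (auto simp: R)
  next
    case False
    then show ?thesis
      unfolding L openin_colimit_topology by auto
  qed
  then show ?thesis by (simp add: topology_eq)
qed

lemma SP2_minus_diagonal_up_to_infinity:
  "SP2_minus_diagonal n = up_to_infinity (\<lambda>i. SP2_minus_diagonal (enat i)) n"
proof (cases n)
  case (enat i)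
  then show ?thesis by (simp add: up_to_infinity_def)
next
  case infinity
  let ?V = "topspace (SP2 \<infinity>) - diagonal \<infinity> :: 'a line uprod set"
  have SP2: "SP2 \<infinity> = colimit_topology (\<lambda>i. SP2 (enat i) :: 'a line uprod topology)"
    by (simp add: SP2_def up_to_infinity_def)
  have Int: "?V \<inter> topspace (SP2 (enat i)) = topspace (SP2 (enat i)) - diagonal (enat i)" for i
    by (auto simp: SP2 diagonal_def KP_def SP2_def up_to_infinity_def symmetric_square_def)
  have "SP2_minus_diagonal (enat i) = subtopology (SP2 (enat i)) ?V" for i
    by (metis Int SP2_minus_diagonal_def inf_commute subtopology_restrict)
  then show ?thesis
    using subtopology_colimit_topology [of "\<lambda>i. SP2 (enat i)" ?V]
    by (simp add: openin_SP2_minus_diagonal infinity SP2_minus_diagonal_def [of \<infinity>]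
        up_to_infinity_def Int flip: SP2)
qed

lemma homeomorphic_map_bent_lines:
  "homeomorphic_map (Do_theta n) (SP2_minus_diagonal n) bent_lines"
  unfolding SP2_minus_diagonal_up_to_infinity [of n] fun_cong [OF Do_theta_up_to_infinity, of n]
  by (intro homeomorphic_map_up_to_infinity homeomorphic_map_bent_lines_enat inj_on_bent_lines)

section \<open>The radial contraction\<close>

text \<open>On frames and vectors the contraction is visibly continuous. It descends to each finite stage since
  \<open>[0, 1]\<close> times the quotient map onto the disc bundle is again a quotient map.\<close>

lemma continuous_map_radial:
  "continuous_map (prod_topology (top_of_set {0..1}) (Do_theta n)) (Do_theta n)
     (\<lambda>(t, E :: (('k::conj_division_algebra) frame \<times> 'k) set). radial t E)"
proof -
  let ?I = "top_of_set {0..1::real}"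
  have I: "locally_compact_space ?I" "regular_space ?I"
    by (simp_all add: compact_imp_locally_compact_space compact_space_subtopology
        regular_space_subtopology regular_space_euclidean)
  have "continuous_map (prod_topology ?I (Do_theta (enat i))) (Do_theta (enat i))
     (\<lambda>(t, E :: ('k frame \<times> 'k) set). radial t E)" for i
  proof -
    let ?P = "top_of_set (Stiefel i \<times> ball 0 1) :: ('k frame \<times> 'k) topology"
    let ?s = "\<lambda>(t, f, k). (f, (1 - t) *\<^sub>R k) :: 'k frame \<times> 'k"
    have "continuous_map (prod_topology ?I ?P) ?P ?s"
    proof -
      have "norm ((1 - t) *\<^sub>R k) < 1" if "0 \<le> t" "t \<le> 1" "norm k < 1" for t and k :: 'k
        using that mult_left_le_one_le [of "norm k" "1 - t"] by simp
      then show ?thesis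
        by (auto simp: split_def simp del: norm_scaleR intro!: continuous_intros)
    qed
    then have "continuous_map (prod_topology ?I ?P) (Do_theta (enat i)) (assoc_class \<circ> ?s)"
      using quotient_imp_continuous_map [OF quotient_map_assoc_class] continuous_map_compose by blast
    moreover have "assoc_class \<circ> ?s = (\<lambda>(t, E). radial t E) \<circ> (\<lambda>(t, p). (t, assoc_class p))"
      by (auto simp: radial_assoc_class)
    ultimately have "continuous_map (prod_topology ?I ?P) (Do_theta (enat i))
        ((\<lambda>(t, E). radial t E) \<circ> (\<lambda>(t, p). (t, assoc_class p)))"
      by (simp only:)
    with quotient_map_prod_right [OF I(1) disjI2 [OF I(2)] quotient_map_assoc_class [of i]]
    show ?thesis by (rule continuous_compose_quotient_map)
  qed
  then show ?thesis
    unfolding fun_cong [OF Do_theta_up_to_infinity, of n]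
    by (rule continuous_map_prod_up_to_infinity [OF I])
qed

lemma topspace_Do_theta:
  "topspace (Do_theta n) =
     (\<Union>m\<in>{m. n = enat m \<or> n = \<infinity>}. assoc_class ` (Stiefel m \<times> ball 0 1))"
  unfolding fun_cong [OF Do_theta_up_to_infinity, of n] topspace_up_to_infinity
  by (simp add: topspace_Do_theta_enat)

lemma topspace_Gamma_space:
  "topspace (Gamma_space n) = (\<Union>m\<in>{m. n = enat m \<or> n = \<infinity>}. frame_orbit ` Stiefel m)"
  by (simp add: Gamma_space_def topspace_up_to_infinity)

lemma zero_section_Gamma_space:
  "zero_section ` topspace (Gamma_space n) =
     (\<Union>m\<in>{m. n = enat m \<or> n = \<infinity>}. (\<lambda>f. assoc_class (f, 0)) ` Stiefel m)"
  by (simp add: topspace_Gamma_space image_UN image_image zero_section_frame_orbit)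

lemma bend_zero: "bend (f, 0) = f"
  by (cases f) (simp add: bend_def)

lemma bent_lines_zero_section:
  "bent_lines ` zero_section ` topspace (Gamma_space n) = Gamma_incl ` topspace (Gamma_space n)"
  by (simp add: topspace_Gamma_space image_UN image_image zero_section_frame_orbit
      bent_lines_assoc_class bend_zero Gamma_incl_frame_orbit)

lemma deformation_retraction_radial:
  "deformation_retraction (Do_theta n) (zero_section ` topspace (Gamma_space n))
     (\<lambda>(t, E :: (('k::conj_division_algebra) frame \<times> 'k) set). radial t E)"
  unfolding deformation_retraction_def zero_section_Gamma_space topspace_Do_theta
  by (fastforce simp: continuous_map_radial radial_assoc_class)

lemma deformation_retraction_homeomorphic_image:
  assumes hom: "homeomorphic_map X Y m" and h: "deformation_retraction X A h"
  obtains h' where "deformation_retraction Y (m ` A) h'"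
    and "\<And>t x. x \<in> topspace X \<Longrightarrow> h' (t, m x) = m (h (t, x))"
proof -
  obtain w where w: "homeomorphic_maps X Y m w"
    using hom homeomorphic_map_maps by blast
  then have m: "continuous_map X Y m" and wc: "continuous_map Y X w"
    and wm: "\<And>x. x \<in> topspace X \<Longrightarrow> w (m x) = x" and mw: "\<And>y. y \<in> topspace Y \<Longrightarrow> m (w y) = y"
    by (auto simp: homeomorphic_maps_def)
  have A: "A \<subseteq> topspace X"
    and hc: "continuous_map (prod_topology (top_of_set {0..1}) X) X h"
    and h0: "\<And>x. x \<in> topspace X \<Longrightarrow> h (0, x) = x"
    and h1: "\<And>x. x \<in> topspace X \<Longrightarrow> h (1, x) \<in> A"
    and hA: "\<And>t a. t \<in> {0..1} \<Longrightarrow> a \<in> A \<Longrightarrow> h (t, a) = a"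
    using h by (auto simp: deformation_retraction_def)
  define h' where "h' = m \<circ> h \<circ> (\<lambda>(t, y). (t, w y))"
  have "continuous_map (prod_topology (top_of_set {0..1}) Y) (prod_topology (top_of_set {0..1}) X)
      (\<lambda>(t, y). (t, w y))"
    using wc continuous_map_id [of "top_of_set {0..1::real}"]
    by (simp add: continuous_map_prod_top id_def)
  then have "continuous_map (prod_topology (top_of_set {0..1}) Y) Y h'"
    unfolding h'_def by (rule continuous_map_compose [OF _ continuous_map_compose [OF hc m]])
  moreover have "w y \<in> topspace X" if "y \<in> topspace Y" for y
    using wc that by (auto simp: continuous_map_def)
  moreover have "m x \<in> topspace Y" if "x \<in> topspace X" for x
    using m that by (auto simp: continuous_map_def)
  ultimately have "deformation_retraction Y (m ` A) h'"
    using A h0 h1 hA wm mw by (auto simp: deformation_retraction_def h'_def subset_iff)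
  moreover have "h' (t, m x) = m (h (t, x))" if "x \<in> topspace X" for t x
    using that by (simp add: h'_def wm)
  ultimately show ?thesis using that by blast
qed

theorem disc_bundle_homeomorphic_SP2_minus_diagonal:
  fixes n :: enat
  shows "\<exists>m :: (('k::conj_division_algebra) frame \<times> 'k) set \<Rightarrow> 'k line uprod.
            homeomorphism_of_pairs
              (Do_theta n) (zero_section ` topspace (Gamma_space n))
              (SP2_minus_diagonal n) (Gamma_incl ` topspace (Gamma_space n)) m \<and>
            (\<exists>h. deformation_retraction
                   (SP2_minus_diagonal n) (Gamma_incl ` topspace (Gamma_space n)) h \<and>
                 (\<forall>t\<in>{0..1}. \<forall>x\<in>topspace (Do_theta n). h (t, m x) = m (radial t x)))"
proof -
  let ?m = "bent_lines :: ('k frame \<times> 'k) set \<Rightarrow> 'k line uprod"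
  obtain h where h: "deformation_retraction (SP2_minus_diagonal n)
      (?m ` zero_section ` topspace (Gamma_space n)) h"
    "\<And>t x. x \<in> topspace (Do_theta n) \<Longrightarrow> h (t, ?m x) = ?m (radial t x)"
    using deformation_retraction_homeomorphic_image
      [OF homeomorphic_map_bent_lines deformation_retraction_radial] by (smt (verit) case_prod_conv)
  have "homeomorphism_of_pairs
      (Do_theta n) (zero_section ` topspace (Gamma_space n))
      (SP2_minus_diagonal n) (Gamma_incl ` topspace (Gamma_space n)) ?m"
    using deformation_retraction_radial [of n, where ?'k = 'k] h(1) homeomorphic_map_bent_lines [of n]
    by (simp add: homeomorphism_of_pairs_def deformation_retraction_def bent_lines_zero_section)
  then show ?thesis
    using h by (auto simp: bent_lines_zero_section)
qed

theorem theorem3p5: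
  fixes n :: enat
  assumes "1 \<le> n"
  shows "(\<exists>m :: (complex frame \<times> complex) set \<Rightarrow> complex line uprod.
            homeomorphism_of_pairs
              (Do_theta n) (zero_section ` topspace (Gamma_space n))
              (SP2_minus_diagonal n) (Gamma_incl ` topspace (Gamma_space n)) m \<and>
            (\<exists>h. deformation_retraction
                   (SP2_minus_diagonal n) (Gamma_incl ` topspace (Gamma_space n)) h \<and>
                 (\<forall>t\<in>{0..1}. \<forall>x\<in>topspace (Do_theta n). h (t, m x) = m (radial t x)))) \<and>
         (\<exists>m :: (quat frame \<times> quat) set \<Rightarrow> quat line uprod.
            homeomorphism_of_pairs
              (Do_theta n) (zero_section ` topspace (Gamma_space n))
              (SP2_minus_diagonal n) (Gamma_incl ` topspace (Gamma_space n)) m \<and>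
            (\<exists>h. deformation_retraction
                   (SP2_minus_diagonal n) (Gamma_incl ` topspace (Gamma_space n)) h \<and>
                 (\<forall>t\<in>{0..1}. \<forall>x\<in>topspace (Do_theta n). h (t, m x) = m (radial t x))))"
  by (intro conjI disc_bundle_homeomorphic_SP2_minus_diagonal)

end
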